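(* Let $g_2,g_3\in\mathbb{R}$ with $\Delta=g_2^3-27g_3^2>0$, and let $w>0$ real and $w'$ purely imaginary with $\mathrm{Im}\,w'>0$ be the fundamental half-periods. For \[ \widetilde{\Psi}_x(k,l)=\frac{\sigma(x+k+l+w')}{\sigma(x+w')\sigma(k+l)}e^{-(\zeta(k)+\zeta(l))x-\zeta(w')(k+l)} \] write $\widetilde{\Psi}_x(k,l)=v(x;k,l)e^{\frac{p(k)+p(l)}{w}x}$, where \[ v(x;a,b)=\frac{\sigma(x+w'+a+b)}{\sigma(x+w')\sigma(a+b)}e^{-\zeta(w')(a+b)-\frac{(a+b)\zeta(w)}{w}x},\qquad p(a)=a\zeta(w)-w\zeta(a). \] Then: (1) $\widetilde{\Psi}_x(k+2w,l)=-\widetilde{\Psi}_x(k,l)$ and $\widetilde{\Psi}_x(k+2w',l)=\widetilde{\Psi}_x(k,l)$. (2) $v(x+2w;k,l)=v(x;k,l)$. (3) $p(k+2w)=p(k)$, $p(k+2w')=p(k)+\pi\mathrm{i}$, $p(-k)=-p(k)$. When $k\in(0,w']$ or $k\in(w,w+w']$, $p(k)$ is purely imaginary; when $k\in(w',w+w')$, $p(k)$ is complex with imaginary part always $\frac{\pi}{2}$; when $k\in(0,w]$, $p(k)$ is real and varies monotonically from $-\infty$ at the origin to $0$ at $w$. Here $(c,d)$, $[c,d]$ etc. for $c,d\in\mathbb{C}$ denote segments in the complex plane from $c$ to $d$.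
   Context: $\sigma,\zeta,\wp$ are the Weierstrass sigma, zeta and elliptic functions with real invariants $g_2,g_3$ ($(\wp')^2=4\wp^3-g_2\wp-g_3$, $\zeta=\sigma'/\sigma$, $\wp=-\zeta'$), with period lattice generated by $2w,2w'$. *)

theory Defs
  imports "HOL-Analysis.Analysis"
begin

definition wlattice :: "complex \<Rightarrow> complex \<Rightarrow> complex set" where
  "wlattice w w' = {2 * of_int m * w + 2 * of_int n * w' | m n. True}"

definition wsigma :: "complex \<Rightarrow> complex \<Rightarrow> complex \<Rightarrow> complex" where
  "wsigma w w' z = lim (\<lambda>N::nat. z * (\<Prod>(m, n) \<in> ({- int N..int N} \<times> {- int N..int N}) - {(0, 0)}.
      (let \<omega> = 2 * of_int m * w + 2 * of_int n * w'
       in (1 - z / \<omega>) * exp (z / \<omega> + z\<^sup>2 / (2 * \<omega>\<^sup>2)))))"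

definition wzeta :: "complex \<Rightarrow> complex \<Rightarrow> complex \<Rightarrow> complex" where
  "wzeta w w' z = deriv (wsigma w w') z / wsigma w w' z"

definition wp :: "complex \<Rightarrow> complex \<Rightarrow> complex \<Rightarrow> complex" where
  "wp w w' z = - deriv (wzeta w w') z"

definition PsiT :: "complex \<Rightarrow> complex \<Rightarrow> complex \<Rightarrow> complex \<Rightarrow> complex \<Rightarrow> complex" where
  "PsiT w w' x k l =
     wsigma w w' (x + k + l + w') / (wsigma w w' (x + w') * wsigma w w' (k + l))
     * exp (- (wzeta w w' k + wzeta w w' l) * x - wzeta w w' w' * (k + l))"

definition vfun :: "complex \<Rightarrow> complex \<Rightarrow> complex \<Rightarrow> complex \<Rightarrow> complex \<Rightarrow> complex" where
  "vfun w w' x a b =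
     wsigma w w' (x + w' + a + b) / (wsigma w w' (x + w') * wsigma w w' (a + b))
     * exp (- wzeta w w' w' * (a + b) - (a + b) * wzeta w w' w / w * x)"

definition pfun :: "complex \<Rightarrow> complex \<Rightarrow> complex \<Rightarrow> complex" where
  "pfun w w' a = a * wzeta w w' w - w * wzeta w w' a"

end

theory Submission
  imports Defs "HOL-Complex_Analysis.Complex_Analysis"
begin

text \<open>
  The defining products of sigma over the lattice points in growing squares, regrouped by square
  shells, form an absolutely and locally uniformly convergent product of entire functions. This
  gives holomorphy, the zeros, the symmetries under \<open>z \<mapsto> - z\<close> and \<open>z \<mapsto> cnj z\<close> and, by
  logarithmic and further differentiation, shell series for zeta and wp. Translating the square of
  summation by a period changes the partial sums of wp only on two boundary shells, which
  contribute \<open>O(1/N)\<close>; so wp is periodic, and integrating twice gives the quasi-periodicity of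
  zeta and sigma. The integral of zeta around the period rectangle, computed once from the pole at
  0 and once by pairing opposite sides via quasi-periodicity, gives Legendre's relation
  \<open>2 (\<eta> w' - \<eta>' w) = \<pi> \<i>\<close>, where \<open>\<eta> = zeta w\<close> and \<open>\<eta>' = zeta w'\<close>. Parts (1) to (3) follow from these facts by algebra.

  For the monotonicity of p on \<open>(0, w]\<close> note \<open>p' = \<eta> + w wp\<close>. On the real axis, on the imaginary
  axis and on the line through w' the function wp is real by reflection symmetry, and the
  differential equation makes \<open>4 wp\<^sup>3 - g\<^sub>2 wp - g\<^sub>3 = wp'\<^sup>2\<close> nonnegative, nonpositive and
  nonnegative there. As this cubic is negative at \<open>s = sqrt (g\<^sub>2 / 12)\<close> and positive at \<open>- s\<close>,
  continuity from the poles gives \<open>wp > s\<close> on \<open>(0, w]\<close>, \<open>wp w' < - s\<close> and \<open>wp < s\<close> on the line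
  through w'. Integrating \<open>zeta' = - wp\<close> along that line yields \<open>\<eta> > - w s\<close>, hence \<open>p' > 0\<close>.
\<close>

section \<open>Square grids of lattice indices\<close>

definition grid :: "nat \<Rightarrow> (int \<times> int) set" where
  "grid N = {- int N..int N} \<times> {- int N..int N}"

definition shell_index :: "int \<times> int \<Rightarrow> nat" where
  "shell_index p = nat (max \<bar>fst p\<bar> \<bar>snd p\<bar>)"

definition grid_shell :: "nat \<Rightarrow> (int \<times> int) set" where
  "grid_shell k = {p. shell_index p = k}"

lemma mem_grid: "p \<in> grid N \<longleftrightarrow> shell_index p \<le> N"
  by (cases p) (auto simp: grid_def shell_index_def)

lemma finite_grid [simp]: "finite (grid N)"
  by (simp add: grid_def)

lemma zero_in_grid: "(0, 0) \<in> grid N"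
  by (simp add: grid_def)

lemma grid_shell_subset_grid: "grid_shell k \<subseteq> grid k"
  by (auto simp: grid_shell_def mem_grid)

lemma finite_grid_shell [simp]: "finite (grid_shell k)"
  using finite_subset[OF grid_shell_subset_grid] by simp

lemma shell_index_eq_0_iff: "shell_index p = 0 \<longleftrightarrow> p = (0, 0)"
  by (cases p) (auto simp: shell_index_def)

lemma grid_shell_0: "grid_shell 0 = {(0, 0)}"
  by (auto simp: grid_shell_def shell_index_eq_0_iff)

lemma grid_eq_UN_grid_shell: "grid N = (\<Union>k<Suc N. grid_shell k)"
  by (auto simp: mem_grid grid_shell_def)

lemma prod_grid_shells: "(\<Prod>k<Suc N. \<Prod>p\<in>grid_shell k. g p) = (\<Prod>p\<in>grid N. g p)"
  unfolding grid_eq_UN_grid_shell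
  by (rule prod.UNION_disjoint[symmetric]) (simp_all, auto simp: grid_shell_def)

lemma sum_grid_shells: "(\<Sum>k<Suc N. \<Sum>p\<in>grid_shell k. g p) = (\<Sum>p\<in>grid N. g p)"
  unfolding grid_eq_UN_grid_shell
  by (rule sum.UNION_disjoint[symmetric]) (simp_all, auto simp: grid_shell_def)

lemma card_grid: "card (grid N) = (2 * N + 1)\<^sup>2"
proof -
  have "card {- int N..int N} = 2 * N + 1"
    by simp
  then show ?thesis
    by (simp add: grid_def card_cartesian_product power2_eq_square)
qed

lemma card_grid_shell:
  assumes "k \<noteq> 0"
  shows "card (grid_shell k) = 8 * k"
proof -
  obtain j where k: "k = Suc j"
    using assms by (cases k) auto
  have "grid_shell k = grid k - grid j" "grid j \<subseteq> grid k"
    by (auto simp: grid_shell_def mem_grid k)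
  then have "card (grid_shell k) = (2 * k + 1)\<^sup>2 - (2 * j + 1)\<^sup>2"
    by (simp add: card_Diff_subset card_grid)
  also have "\<dots> = 8 * k"
    by (simp add: k power2_eq_square algebra_simps)
  finally show ?thesis .
qed

lemma shell_index_translate_le:
  assumes "\<bar>fst e\<bar> \<le> 1" "\<bar>snd e\<bar> \<le> 1"
  shows "shell_index (fst p - fst e, snd p - snd e) \<le> Suc (shell_index p)"
proof -
  have "\<bar>fst p - fst e\<bar> \<le> \<bar>fst p\<bar> + 1" "\<bar>snd p - snd e\<bar> \<le> \<bar>snd p\<bar> + 1"
    using assms by arith+
  then show ?thesis
    unfolding shell_index_def by (auto simp: nat_le_iff max_def)
qed

lemma grid_translate_diff_subset:
  assumes e: "\<bar>fst e\<bar> \<le> 1" "\<bar>snd e\<bar> \<le> 1"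
  defines "h \<equiv> \<lambda>p. (fst p - fst e, snd p - snd e)"
  shows "h ` grid N - grid N \<subseteq> grid_shell (Suc N)"
    and "grid N - h ` grid N \<subseteq> grid_shell N"
proof -
  show "h ` grid N - grid N \<subseteq> grid_shell (Suc N)"
  proof
    fix q assume q: "q \<in> h ` grid N - grid N"
    then obtain p where p: "p \<in> grid N" "q = h p"
      by blast
    then have "shell_index q \<le> Suc N"
      using shell_index_translate_le[OF e, of p] by (simp add: h_def mem_grid)
    with q show "q \<in> grid_shell (Suc N)"
      by (simp add: grid_shell_def mem_grid)
  qed
  show "grid N - h ` grid N \<subseteq> grid_shell N"
  proof
    fix q assume q: "q \<in> grid N - h ` grid N"
    define p where "p = (fst q + fst e, snd q + snd e)"
    have "q = h p" by (simp add: h_def p_def)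
    with q have "N < shell_index p" by (auto simp: mem_grid)
    moreover have "shell_index p \<le> Suc (shell_index q)"
      using shell_index_translate_le[of "(- fst e, - snd e)" q] e by (simp add: p_def)
    ultimately show "q \<in> grid_shell N"
      using q by (simp add: grid_shell_def mem_grid)
  qed
qed

section \<open>The rectangular period lattice\<close>

definition lattice_point :: "complex \<Rightarrow> complex \<Rightarrow> int \<times> int \<Rightarrow> complex" where
  "lattice_point w w' p = 2 * of_int (fst p) * w + 2 * of_int (snd p) * w'"

lemma wlattice_eq_range: "wlattice w w' = range (lattice_point w w')"
proof (intro set_eqI iffI)
  fix z assume "z \<in> wlattice w w'"
  then obtain m n where "z = 2 * of_int m * w + 2 * of_int n * w'"
    by (auto simp: wlattice_def)
  then show "z \<in> range (lattice_point w w')"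
    by (intro range_eqI[of _ _ "(m, n)"]) (simp add: lattice_point_def)
qed (auto simp: wlattice_def lattice_point_def)

lemma lattice_point_0 [simp]: "lattice_point w w' (0, 0) = 0"
  by (simp add: lattice_point_def)

lemma lattice_point_add:
  "lattice_point w w' p + lattice_point w w' q = lattice_point w w' (fst p + fst q, snd p + snd q)"
  by (simp add: lattice_point_def algebra_simps)

lemma lattice_point_diff:
  "lattice_point w w' p - lattice_point w w' q = lattice_point w w' (fst p - fst q, snd p - snd q)"
  by (simp add: lattice_point_def algebra_simps)

locale rect_lattice =
  fixes w w' :: complex
  assumes w_real: "Im w = 0" and w_pos: "Re w > 0"
    and w'_imag: "Re w' = 0" and w'_pos: "Im w' > 0"
begin

abbreviation \<Lambda> :: "complex set" where "\<Lambda> \<equiv> wlattice w w'"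
abbreviation lpoint :: "int \<times> int \<Rightarrow> complex" where "lpoint \<equiv> lattice_point w w'"
abbreviation \<sigma> :: "complex \<Rightarrow> complex" where "\<sigma> \<equiv> wsigma w w'"
abbreviation \<zeta> :: "complex \<Rightarrow> complex" where "\<zeta> \<equiv> wzeta w w'"
abbreviation wp_fun :: "complex \<Rightarrow> complex" ("\<wp>") where "\<wp> \<equiv> wp w w'"

definition gap :: real where
  "gap = min (Re w) (Im w')"

lemma gap_pos: "gap > 0"
  using w_pos w'_pos by (simp add: gap_def)

lemma Re_lpoint: "Re (lpoint p) = 2 * of_int (fst p) * Re w"
  using w'_imag by (simp add: lattice_point_def)

lemma Im_lpoint: "Im (lpoint p) = 2 * of_int (snd p) * Im w'"
  using w_real by (simp add: lattice_point_def)

lemma norm_lpoint_ge: "2 * gap * shell_index p \<le> norm (lpoint p)"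
proof (cases "\<bar>snd p\<bar> \<le> \<bar>fst p\<bar>")
  case True
  then have "real (shell_index p) = \<bar>of_int (fst p)\<bar>"
    by (simp add: shell_index_def)
  moreover have "gap * \<bar>of_int (fst p)\<bar> \<le> Re w * \<bar>of_int (fst p)\<bar>"
    by (intro mult_right_mono) (auto simp: gap_def)
  ultimately have "2 * gap * shell_index p \<le> \<bar>Re (lpoint p)\<bar>"
    using w_pos by (simp add: Re_lpoint abs_mult mult_ac)
  then show ?thesis
    using abs_Re_le_cmod order_trans by blast
next
  case False
  then have "real (shell_index p) = \<bar>of_int (snd p)\<bar>"
    by (simp add: shell_index_def)
  moreover have "gap * \<bar>of_int (snd p)\<bar> \<le> Im w' * \<bar>of_int (snd p)\<bar>"
    by (intro mult_right_mono) (auto simp: gap_def)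
  ultimately have "2 * gap * shell_index p \<le> \<bar>Im (lpoint p)\<bar>"
    using w'_pos by (simp add: Im_lpoint abs_mult mult_ac)
  then show ?thesis
    using abs_Im_le_cmod order_trans by blast
qed

lemma lpoint_eq_0_iff: "lpoint p = 0 \<longleftrightarrow> p = (0, 0)"
proof
  assume "lpoint p = 0"
  then have "gap * shell_index p \<le> 0"
    using norm_lpoint_ge[of p] by (simp add: mult_ac)
  then have "shell_index p = 0"
    using gap_pos by (simp add: mult_le_0_iff)
  then show "p = (0, 0)"
    by (simp add: shell_index_eq_0_iff)
qed simp

lemma lpoint_in_lattice: "lpoint p \<in> \<Lambda>"
  by (simp add: wlattice_eq_range)

lemma add_lattice_iff:
  assumes "P \<in> \<Lambda>"
  shows "z + P \<in> \<Lambda> \<longleftrightarrow> z \<in> \<Lambda>"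
proof -
  obtain q where q: "P = lpoint q"
    using assms by (auto simp: wlattice_eq_range)
  have "z + P \<in> \<Lambda>" if "z = lpoint p" for p
    unfolding that q lattice_point_add by (rule lpoint_in_lattice)
  moreover have "z \<in> \<Lambda>" if "z + P = lpoint p" for p
  proof -
    have "z = lpoint p - lpoint q"
      using that q by (simp add: algebra_simps)
    then show ?thesis
      unfolding lattice_point_diff by (simp add: lpoint_in_lattice)
  qed
  ultimately show ?thesis
    by (auto simp: wlattice_eq_range)
qed

lemma uminus_lattice_iff: "- z \<in> \<Lambda> \<longleftrightarrow> z \<in> \<Lambda>"
proof -
  have "- z \<in> \<Lambda>" if z: "z \<in> \<Lambda>" for z
  proof -
    obtain p where "z = lpoint p"
      using z unfolding wlattice_eq_range by blast
    then have "- z = lpoint (0, 0) - lpoint p"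
      by simp
    then show ?thesis
      unfolding lattice_point_diff by (simp add: lpoint_in_lattice)
  qed
  then show ?thesis
    by (metis minus_minus)
qed

lemma cnj_lpoint: "cnj (lpoint p) = lpoint (fst p, - snd p)"
  using w_real w'_imag by (simp add: lattice_point_def complex_eq_iff)

lemma cnj_lattice_iff: "cnj z \<in> \<Lambda> \<longleftrightarrow> z \<in> \<Lambda>"
proof -
  have "cnj z \<in> \<Lambda>" if z: "z \<in> \<Lambda>" for z
  proof -
    obtain p where "z = lpoint p"
      using z unfolding wlattice_eq_range by blast
    then show ?thesis
      by (simp add: cnj_lpoint lpoint_in_lattice)
  qed
  then show ?thesis
    by (metis complex_cnj_cnj)
qed

lemma countable_lattice: "countable \<Lambda>"
  by (simp add: wlattice_eq_range)

lemma connected_lattice_complement: "connected (- \<Lambda>)"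
  using path_connected_complement_countable[OF _ countable_lattice] path_connected_imp_connected
  by simp

lemma not_in_lattice_ReI:
  assumes "2 * of_int j * Re w < Re z" "Re z < 2 * of_int (j + 1) * Re w"
  shows "z \<notin> \<Lambda>"
proof
  assume "z \<in> \<Lambda>"
  then obtain p where "z = lpoint p"
    by (auto simp: wlattice_eq_range)
  then have "of_int j * (2 * Re w) < of_int (fst p) * (2 * Re w)"
    "of_int (fst p) * (2 * Re w) < of_int (j + 1) * (2 * Re w)"
    using assms by (simp_all add: Re_lpoint mult_ac)
  then have "j < fst p" "fst p < j + 1"
    using w_pos by (simp_all only: mult_less_cancel_right of_int_less_iff)
  then show False
    by simp
qed

lemma not_in_lattice_ImI:
  assumes "2 * of_int j * Im w' < Im z" "Im z < 2 * of_int (j + 1) * Im w'"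
  shows "z \<notin> \<Lambda>"
proof
  assume "z \<in> \<Lambda>"
  then obtain p where "z = lpoint p"
    by (auto simp: wlattice_eq_range)
  then have "of_int j * (2 * Im w') < of_int (snd p) * (2 * Im w')"
    "of_int (snd p) * (2 * Im w') < of_int (j + 1) * (2 * Im w')"
    using assms by (simp_all add: Im_lpoint mult_ac)
  then have "j < snd p" "snd p < j + 1"
    using w'_pos by (simp_all only: mult_less_cancel_right of_int_less_iff)
  then show False
    by simp
qed

lemma w_notin_lattice: "w \<notin> \<Lambda>"
  using not_in_lattice_ReI[of 0 w] w_pos by simp

lemma w'_notin_lattice: "w' \<notin> \<Lambda>"
  using not_in_lattice_ImI[of 0 w'] w'_pos by simp

lemma two_w_eq_lpoint: "2 * w = lpoint (1, 0)"
  and two_w'_eq_lpoint: "2 * w' = lpoint (0, 1)"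
  by (simp_all add: lattice_point_def)

end

section \<open>The sigma function as a product over square shells\<close>

lemma weierstrass_factor_2: "weierstrass_factor 2 u = (1 - u) * exp (u + u\<^sup>2 / 2)"
  by (simp add: weierstrass_factor_def eval_nat_numeral)

lemma cnj_weierstrass_factor_2: "cnj (weierstrass_factor 2 u) = weierstrass_factor 2 (cnj u)"
  by (simp add: weierstrass_factor_2 exp_cnj)

lemma norm_prod_minus1_le_prod_minus1':
  fixes f :: "'b \<Rightarrow> 'a :: {real_normed_div_algebra,comm_ring_1}"
  shows "norm (prod (\<lambda>n. 1 + f n) A - 1) \<le> prod (\<lambda>n. 1 + norm (f n)) A - 1"
proof (induction A rule: infinite_finite_induct)
  case (insert x A)
  from insert.hyps have
    "norm ((\<Prod>n\<in>insert x A. 1 + f n) - 1) =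
       norm ((\<Prod>n\<in>A. 1 + f n) - 1 + f x * (\<Prod>n\<in>A. 1 + f n))"
    by (simp add: algebra_simps)
  also have "\<dots> \<le> norm ((\<Prod>n\<in>A. 1 + f n) - 1) + norm (f x * (\<Prod>n\<in>A. 1 + f n))"
    by (rule norm_triangle_ineq)
  also have "norm (f x * (\<Prod>n\<in>A. 1 + f n)) = norm (f x) * (\<Prod>x\<in>A. norm (1 + f x))"
    by (simp add: prod_norm norm_mult)
  also have "(\<Prod>x\<in>A. norm (1 + f x)) \<le> (\<Prod>x\<in>A. norm (1::'a) + norm (f x))"
    by (intro prod_mono norm_triangle_ineq ballI conjI) auto
  also have "norm (1::'a) = 1"
    by simp
  also note insert.IH
  also have "(\<Prod>n\<in>A. 1 + norm (f n)) - 1 + norm (f x) * (\<Prod>x\<in>A. 1 + norm (f x)) =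
             (\<Prod>n\<in>insert x A. 1 + norm (f n)) - 1"
    using insert.hyps by (simp add: algebra_simps)
  finally show ?case
    by (simp_all add: mult_left_mono)
qed simp_all

lemma exp_minus_one_le:
  fixes s b :: real
  assumes "0 \<le> s" "s \<le> b"
  shows "exp s - 1 \<le> s * exp b"
proof -
  have "(1 - s) * exp s \<le> exp (- s) * exp s"
    using exp_ge_add_one_self[of "- s"] by (intro mult_right_mono) auto
  then have "exp s - 1 \<le> s * exp s"
    by (simp add: exp_minus field_simps)
  also have "\<dots> \<le> s * exp b"
    using assms by (intro mult_left_mono) auto
  finally show ?thesis .
qed

lemma summable_const_div_square: "summable (\<lambda>k::nat. C / (real k)\<^sup>2)"
  using summable_mult[OF inverse_power_summable[of 2], of C]
  by (simp add: field_simps)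

context rect_lattice
begin

definition wfactor :: "int \<times> int \<Rightarrow> complex \<Rightarrow> complex" where
  "wfactor p z = (if p = (0, 0) then z else weierstrass_factor 2 (z / lpoint p))"

definition shell_factor :: "nat \<Rightarrow> complex \<Rightarrow> complex" where
  "shell_factor k z = (\<Prod>p\<in>grid_shell k. wfactor p z)"

lemma wfactor_eq_0_iff: "wfactor p z = 0 \<longleftrightarrow> z = lpoint p"
proof (cases "p = (0, 0)")
  case False
  then have "lpoint p \<noteq> 0"
    by (simp add: lpoint_eq_0_iff)
  with False show ?thesis
    by (simp add: wfactor_def weierstrass_factor_2)
qed (simp add: wfactor_def)

lemma holomorphic_wfactor [holomorphic_intros]: "wfactor p holomorphic_on A"
  by (cases "p = (0, 0)") (auto simp: wfactor_def[abs_def] lpoint_eq_0_iff intro!: holomorphic_intros)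

lemma holomorphic_shell_factor [holomorphic_intros]: "shell_factor k holomorphic_on A"
  unfolding shell_factor_def[abs_def] by (intro holomorphic_intros)

lemma shell_products_eq_grid_product:
  "(\<Prod>k<Suc N. shell_factor k z) = (\<Prod>p\<in>grid N. wfactor p z)"
  unfolding shell_factor_def by (rule prod_grid_shells)

lemma wsigma_eq_lim_grid_products: "\<sigma> z = lim (\<lambda>N. \<Prod>p\<in>grid N. wfactor p z)"
proof -
  have "z * (\<Prod>(m, n) \<in> grid N - {(0, 0)}.
      (let \<omega> = 2 * of_int m * w + 2 * of_int n * w'
       in (1 - z / \<omega>) * exp (z / \<omega> + z\<^sup>2 / (2 * \<omega>\<^sup>2)))) = (\<Prod>p\<in>grid N. wfactor p z)" for N
  proof -
    have "(\<Prod>(m, n) \<in> grid N - {(0, 0)}.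
      (let \<omega> = 2 * of_int m * w + 2 * of_int n * w'
       in (1 - z / \<omega>) * exp (z / \<omega> + z\<^sup>2 / (2 * \<omega>\<^sup>2)))) = (\<Prod>p\<in>grid N - {(0, 0)}. wfactor p z)"
      by (intro prod.cong refl)
         (auto simp: wfactor_def weierstrass_factor_2 lattice_point_def Let_def power_divide
           mult.commute[of _ 2])
    moreover have "(\<Prod>p\<in>grid N. wfactor p z) = wfactor (0, 0) z * (\<Prod>p\<in>grid N - {(0, 0)}. wfactor p z)"
      by (rule prod.remove) (simp_all add: zero_in_grid)
    ultimately show ?thesis
      by (simp add: wfactor_def)
  qed
  then show ?thesis
    unfolding wsigma_def grid_def by presburger
qed

lemma norm_wfactor_minus1_le:
  assumes p: "p \<in> grid_shell k" and k: "k \<noteq> 0" and z: "norm z \<le> R" and R: "R \<le> gap * k"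
  shows "norm (wfactor p z - 1) \<le> 3 * (R / gap) ^ 3 / (8 * real k ^ 3)"
proof -
  have p0: "p \<noteq> (0, 0)"
    using p k by (auto simp: grid_shell_def shell_index_def)
  have lp: "2 * gap * k \<le> norm (lpoint p)"
    using norm_lpoint_ge[of p] p by (simp add: grid_shell_def)
  have pos: "0 < 2 * gap * k"
    using gap_pos k by simp
  have small: "norm (z / lpoint p) \<le> R / (2 * gap * k)"
    unfolding norm_divide using z lp pos norm_ge_zero[of z] by (intro frac_le) linarith+
  also have "\<dots> \<le> 1 / 2"
    using R pos by (simp add: field_simps)
  finally have "norm (wfactor p z - 1) \<le> 3 * norm (z / lpoint p) ^ 3"
    using weierstrass_factor_bound[of "z / lpoint p" 2] p0 by (simp add: wfactor_def)
  also have "\<dots> \<le> 3 * (R / (2 * gap * k)) ^ 3"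
    using small by (intro mult_left_mono power_mono) auto
  also have "\<dots> = 3 * (R / gap) ^ 3 / (8 * real k ^ 3)"
    by (simp add: field_simps power3_eq_cube)
  finally show ?thesis .
qed

lemma norm_shell_factor_minus1_le:
  assumes z: "norm z \<le> R" and k: "k \<noteq> 0" and R: "R \<le> gap * k"
  shows "norm (shell_factor k z - 1) \<le> 3 * (R / gap) ^ 3 * exp (3 * (R / gap) ^ 3) / (real k)\<^sup>2"
proof -
  define B where "B = 3 * (R / gap) ^ 3"
  have "0 \<le> R"
    using z norm_ge_zero order_trans by blast
  then have "0 \<le> B"
    using gap_pos by (simp add: B_def)
  have "(\<Sum>p\<in>grid_shell k. norm (wfactor p z - 1)) \<le> card (grid_shell k) * (B / (8 * real k ^ 3))"
    using norm_wfactor_minus1_le[OF _ k z R] by (intro sum_bounded_above) (simp add: B_def)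
  also have "\<dots> = B / (real k)\<^sup>2"
    using k by (simp add: card_grid_shell power3_eq_cube power2_eq_square)
  finally have sum_le: "(\<Sum>p\<in>grid_shell k. norm (wfactor p z - 1)) \<le> B / (real k)\<^sup>2" .
  have "norm (shell_factor k z - 1) \<le> (\<Prod>p\<in>grid_shell k. 1 + norm (wfactor p z - 1)) - 1"
    using norm_prod_minus1_le_prod_minus1'[of "\<lambda>p. wfactor p z - 1" "grid_shell k"]
    by (simp add: shell_factor_def)
  also have "\<dots> \<le> exp (\<Sum>p\<in>grid_shell k. norm (wfactor p z - 1)) - 1"
    using prod_le_exp_sum[of "grid_shell k" "\<lambda>p. norm (wfactor p z - 1)"] by simp
  also have "\<dots> \<le> exp (B / (real k)\<^sup>2) - 1"
    using sum_le by simp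
  also have "\<dots> \<le> B / (real k)\<^sup>2 * exp B"
  proof (rule exp_minus_one_le)
    have "B / (real k)\<^sup>2 \<le> B / 1"
      using \<open>0 \<le> B\<close> k by (intro divide_left_mono) auto
    then show "B / (real k)\<^sup>2 \<le> B"
      by simp
  qed (use \<open>0 \<le> B\<close> in simp)
  finally show ?thesis
    by (simp add: B_def)
qed

lemma eventually_gap_mult_ge: "eventually (\<lambda>k. k \<noteq> 0 \<and> R \<le> gap * k) sequentially"
proof -
  have "eventually (\<lambda>k. nat \<lceil>R / gap\<rceil> + 1 \<le> k) sequentially"
    by (rule eventually_ge_at_top)
  then show ?thesis
  proof eventually_elim
    case (elim k)
    then have "R / gap \<le> real k"
      by linarith
    with elim gap_pos show ?case
      by (auto simp: field_simps)
  qed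
qed

lemma obtain_gap_mult_ge:
  obtains K :: nat where "K \<noteq> 0" "R \<le> gap * K"
proof -
  from eventually_gap_mult_ge[of R] obtain N where "\<forall>n\<ge>N. n \<noteq> 0 \<and> R \<le> gap * real n"
    unfolding eventually_sequentially by blast
  with that show ?thesis
    by blast
qed

lemma norm_shell_factor_minus1_bound:
  "\<forall>\<^sub>F k in sequentially. \<forall>z\<in>cball 0 R.
     norm (shell_factor k z - 1) \<le> 3 * (R / gap) ^ 3 * exp (3 * (R / gap) ^ 3) / (real k)\<^sup>2"
  using eventually_gap_mult_ge[of R]
  by eventually_elim (auto intro: norm_shell_factor_minus1_le)

lemma uniformly_convergent_shell_products:
  "uniformly_convergent_on (cball 0 R) (\<lambda>N z. \<Prod>k<N. shell_factor k z)"
proof (rule uniformly_convergent_on_prod'[OF _ compact_cball])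
  show "continuous_on (cball 0 R) (shell_factor k)" for k
    by (intro holomorphic_on_imp_continuous_on holomorphic_shell_factor)
  show "uniformly_convergent_on (cball 0 R) (\<lambda>N z. \<Sum>k<N. norm (shell_factor k z - 1))"
    by (rule Weierstrass_m_test'_ev[OF _ summable_const_div_square])
       (use norm_shell_factor_minus1_bound[of R] in simp)
qed

lemma convergent_prod_shell_factor: "convergent_prod (\<lambda>k. shell_factor k z)"
proof -
  have "summable (\<lambda>k. norm (shell_factor k z - 1))"
  proof (rule summable_comparison_test_ev[OF _ summable_const_div_square])
    show "\<forall>\<^sub>F k in sequentially. norm (norm (shell_factor k z - 1))
        \<le> 3 * (norm z / gap) ^ 3 * exp (3 * (norm z / gap) ^ 3) / (real k)\<^sup>2"
      using norm_shell_factor_minus1_bound[of "norm z"] by eventually_elim auto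
  qed
  then show ?thesis
    by (intro abs_convergent_prod_imp_convergent_prod) (simp add: abs_convergent_prod_conv_summable)
qed

lemma grid_products_LIMSEQ: "(\<lambda>N. \<Prod>p\<in>grid N. wfactor p z) \<longlonglongrightarrow> \<sigma> z"
proof -
  have "(\<lambda>N. \<Prod>p\<in>grid N. wfactor p z) \<longlonglongrightarrow> prodinf (\<lambda>k. shell_factor k z)"
    using convergent_prod_LIMSEQ[OF convergent_prod_shell_factor]
    by (simp add: shell_products_eq_grid_product[symmetric] lessThan_Suc_atMost)
  moreover from this have "\<sigma> z = prodinf (\<lambda>k. shell_factor k z)"
    unfolding wsigma_eq_lim_grid_products by (rule limI)
  ultimately show ?thesis
    by simp
qed

lemma shell_factor_has_prod: "(\<lambda>k. shell_factor k z) has_prod \<sigma> z"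
proof -
  have "(\<lambda>N. \<Prod>k\<le>N. shell_factor k z) \<longlonglongrightarrow> \<sigma> z"
    using grid_products_LIMSEQ by (simp add: shell_products_eq_grid_product[symmetric] lessThan_Suc_atMost)
  then have "prodinf (\<lambda>k. shell_factor k z) = \<sigma> z"
    using convergent_prod_LIMSEQ[OF convergent_prod_shell_factor] LIMSEQ_unique by blast
  then show ?thesis
    using convergent_prod_has_prod[OF convergent_prod_shell_factor[of z]] by simp
qed

lemma shell_products_LIMSEQ: "(\<lambda>N. \<Prod>k<N. shell_factor k z) \<longlonglongrightarrow> \<sigma> z"
  by (rule LIMSEQ_imp_Suc) (unfold shell_products_eq_grid_product, rule grid_products_LIMSEQ)

lemma shell_products_uniform_limit:
  "uniform_limit (cball 0 R) (\<lambda>N z. \<Prod>k<N. shell_factor k z) \<sigma> sequentially"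
proof -
  obtain g where g: "uniform_limit (cball 0 R) (\<lambda>N z. \<Prod>k<N. shell_factor k z) g sequentially"
    using uniformly_convergent_shell_products[of R] by (auto simp: uniformly_convergent_on_def)
  moreover have "g z = \<sigma> z" if "z \<in> cball 0 R" for z
    using tendsto_uniform_limitI[OF g that] shell_products_LIMSEQ LIMSEQ_unique by blast
  ultimately show ?thesis
    by (metis (mono_tags, lifting) uniform_limit_cong')
qed

lemma holomorphic_wsigma [holomorphic_intros]: "\<sigma> holomorphic_on A"
proof (rule holomorphic_on_subset)
  show "\<sigma> holomorphic_on UNIV"
  proof (rule holomorphic_uniform_sequence[OF open_UNIV])
    fix z :: complex
    have "uniform_limit (cball z 1) (\<lambda>N z. \<Prod>k<N. shell_factor k z) \<sigma> sequentially"
      by (rule uniform_limit_on_subset[OF shell_products_uniform_limit[of "norm z + 1"]])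
         (simp add: cball_subset_cball_iff)
    then show "\<exists>d>0. cball z d \<subseteq> UNIV \<and>
        uniform_limit (cball z d) (\<lambda>N z. \<Prod>k<N. shell_factor k z) \<sigma> sequentially"
      by (intro exI[of _ 1]) auto
  qed (intro holomorphic_intros)
qed simp

lemma wsigma_eq_0_iff: "\<sigma> z = 0 \<longleftrightarrow> z \<in> \<Lambda>"
proof -
  have "\<sigma> z = 0 \<longleftrightarrow> (\<exists>k. \<exists>p\<in>grid_shell k. wfactor p z = 0)"
    using has_prod_eq_0_iff[OF shell_factor_has_prod] by (auto simp: shell_factor_def image_iff)
  also have "\<dots> \<longleftrightarrow> (\<exists>p. z = lpoint p)"
    by (auto simp: wfactor_eq_0_iff grid_shell_def)
  finally show ?thesis
    by (auto simp: wlattice_eq_range)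
qed

lemma wsigma_minus: "\<sigma> (- z) = - \<sigma> z"
proof -
  define neg :: "int \<times> int \<Rightarrow> int \<times> int" where "neg p = (- fst p, - snd p)" for p
  have bij: "bij_betw neg (grid N - {(0, 0)}) (grid N - {(0, 0)})" for N
    by (rule bij_betwI[where g = neg]) (auto simp: neg_def grid_def)
  have factor: "wfactor p (- z) = wfactor (neg p) z" if "p \<noteq> (0, 0)" for p
  proof -
    have "neg p \<noteq> (0, 0)" "lpoint (neg p) = - lpoint p"
      using that by (cases p) (auto simp: neg_def lattice_point_def)
    with that show ?thesis
      by (simp add: wfactor_def)
  qed
  have products: "(\<Prod>p\<in>grid N. wfactor p (- z)) = - (\<Prod>p\<in>grid N. wfactor p z)" for N
  proof -
    have "(\<Prod>p\<in>grid N. wfactor p (- z)) = wfactor (0, 0) (- z) * (\<Prod>p\<in>grid N - {(0, 0)}. wfactor p (- z))"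
      by (rule prod.remove[OF finite_grid zero_in_grid])
    also have "(\<Prod>p\<in>grid N - {(0, 0)}. wfactor p (- z)) = (\<Prod>p\<in>grid N - {(0, 0)}. wfactor (neg p) z)"
      by (rule prod.cong) (auto simp: factor)
    also have "\<dots> = (\<Prod>p\<in>grid N - {(0, 0)}. wfactor p z)"
      by (rule prod.reindex_bij_betw[OF bij])
    also have "wfactor (0, 0) (- z) = - wfactor (0, 0) z"
      by (simp add: wfactor_def)
    finally show ?thesis
      by (simp add: prod.remove[OF finite_grid zero_in_grid])
  qed
  then have "(\<lambda>N. \<Prod>p\<in>grid N. wfactor p (- z)) \<longlonglongrightarrow> - \<sigma> z"
    unfolding products by (intro tendsto_minus grid_products_LIMSEQ)
  then show ?thesis
    using grid_products_LIMSEQ[of "- z"] LIMSEQ_unique by blast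
qed

lemma wsigma_cnj: "\<sigma> (cnj z) = cnj (\<sigma> z)"
proof -
  define conj :: "int \<times> int \<Rightarrow> int \<times> int" where "conj p = (fst p, - snd p)" for p
  have bij: "bij_betw conj (grid N) (grid N)" for N
    by (rule bij_betwI[where g = conj]) (auto simp: conj_def grid_def)
  have factor: "wfactor p (cnj z) = cnj (wfactor (conj p) z)" for p
  proof (cases "p = (0, 0)")
    case False
    then have "conj p \<noteq> (0, 0)"
      by (cases p) (simp add: conj_def)
    moreover have "cnj (lpoint (conj p)) = lpoint p"
      by (simp add: cnj_lpoint conj_def)
    ultimately show ?thesis
      using False by (simp add: wfactor_def cnj_weierstrass_factor_2)
  qed (simp add: wfactor_def conj_def)
  have products: "(\<Prod>p\<in>grid N. wfactor p (cnj z)) = cnj (\<Prod>p\<in>grid N. wfactor p z)" for N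
  proof -
    have "(\<Prod>p\<in>grid N. wfactor p (cnj z)) = cnj (\<Prod>p\<in>grid N. wfactor (conj p) z)"
      by (simp add: factor cnj_prod)
    also have "(\<Prod>p\<in>grid N. wfactor (conj p) z) = (\<Prod>p\<in>grid N. wfactor p z)"
      by (rule prod.reindex_bij_betw[OF bij])
    finally show ?thesis .
  qed
  then have "(\<lambda>N. \<Prod>p\<in>grid N. wfactor p (cnj z)) \<longlonglongrightarrow> cnj (\<sigma> z)"
    unfolding products by (intro tendsto_cnj grid_products_LIMSEQ)
  then show ?thesis
    using grid_products_LIMSEQ[of "cnj z"] LIMSEQ_unique by blast
qed

end

section \<open>The zeta and wp functions\<close>

lemma has_field_derivative_odd_fun:
  fixes f :: "complex \<Rightarrow> complex"
  assumes odd: "\<And>z. f (- z) = - f z" and D: "(f has_field_derivative D) (at z)"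
  shows "(f has_field_derivative D) (at (- z))"
proof -
  have "((\<lambda>x. f (- x)) has_field_derivative D * (- 1)) (at (- z))"
    by (rule DERIV_chain'[of uminus]) (auto intro!: derivative_eq_intros simp: D)
  then have "((\<lambda>x. - f (- x)) has_field_derivative D) (at (- z))"
    using DERIV_minus by fastforce
  moreover have "(\<lambda>x. - f (- x)) = f"
    using odd by (simp add: fun_eq_iff)
  ultimately show ?thesis
    by simp
qed

lemma has_field_derivative_cnj_symmetric:
  fixes f :: "complex \<Rightarrow> complex"
  assumes sym: "\<And>z. f (cnj z) = cnj (f z)" and D: "(f has_field_derivative D) (at z)"
  shows "(f has_field_derivative cnj D) (at (cnj z))"
proof -
  have "((cnj \<circ> f \<circ> cnj) has_field_derivative cnj D) (at (cnj z))"
    by (rule has_field_derivative_cnj_cnj) (simp add: D)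
  moreover have "cnj \<circ> f \<circ> cnj = f"
    using sym by (simp add: fun_eq_iff)
  ultimately show ?thesis
    by simp
qed

context rect_lattice
begin

lemma open_lattice_complement: "open (- \<Lambda>)"
proof -
  have "closed {z. \<sigma> z = 0}"
    by (intro closed_Collect_eq continuous_on_const holomorphic_on_imp_continuous_on
        holomorphic_wsigma)
  moreover have "- \<Lambda> = - {z. \<sigma> z = 0}"
    by (auto simp: wsigma_eq_0_iff)
  ultimately show ?thesis
    by (simp add: open_Compl)
qed

lemma wsigma_has_field_derivative: "(\<sigma> has_field_derivative deriv \<sigma> z) (at z)"
  using holomorphic_derivI[OF holomorphic_wsigma open_UNIV] by simp

lemma deriv_wsigma_eq: "z \<notin> \<Lambda> \<Longrightarrow> deriv \<sigma> z = \<sigma> z * \<zeta> z"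
  by (simp add: wzeta_def wsigma_eq_0_iff)

lemma holomorphic_wzeta: "\<zeta> holomorphic_on - \<Lambda>"
  unfolding wzeta_def[abs_def]
  by (intro holomorphic_intros holomorphic_deriv open_lattice_complement)
     (auto simp: wsigma_eq_0_iff)

lemma holomorphic_wp: "\<wp> holomorphic_on - \<Lambda>"
  unfolding wp_def[abs_def]
  by (intro holomorphic_intros holomorphic_deriv holomorphic_wzeta open_lattice_complement)

lemma wzeta_has_field_derivative: "z \<notin> \<Lambda> \<Longrightarrow> (\<zeta> has_field_derivative - \<wp> z) (at z)"
  using holomorphic_derivI[OF holomorphic_wzeta open_lattice_complement, of z] by (simp add: wp_def)

lemma wp_has_field_derivative: "z \<notin> \<Lambda> \<Longrightarrow> (\<wp> has_field_derivative deriv \<wp> z) (at z)"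
  using holomorphic_derivI[OF holomorphic_wp open_lattice_complement, of z] by simp

lemma continuous_on_wzeta: "A \<inter> \<Lambda> = {} \<Longrightarrow> continuous_on A \<zeta>"
  by (rule continuous_on_subset[OF holomorphic_on_imp_continuous_on[OF holomorphic_wzeta]]) auto

text \<open>Both symmetries of zeta hold on all of \<open>\<complex>\<close>: at lattice points both sides are the junk
  value \<open>deriv \<sigma> z / 0 = 0\<close>.\<close>

lemma wzeta_minus: "\<zeta> (- z) = - \<zeta> z"
proof -
  have "deriv \<sigma> (- z) = deriv \<sigma> z"
    using has_field_derivative_odd_fun[OF wsigma_minus wsigma_has_field_derivative]
    by (rule DERIV_unique[OF wsigma_has_field_derivative])
  then show ?thesis
    by (simp add: wzeta_def wsigma_minus)
qed

lemma wzeta_cnj: "\<zeta> (cnj z) = cnj (\<zeta> z)"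
proof -
  have "deriv \<sigma> (cnj z) = cnj (deriv \<sigma> z)"
    using has_field_derivative_cnj_symmetric[OF wsigma_cnj wsigma_has_field_derivative]
    by (rule DERIV_unique[OF wsigma_has_field_derivative])
  then show ?thesis
    by (simp add: wzeta_def wsigma_cnj)
qed

lemma wp_minus:
  assumes "z \<notin> \<Lambda>"
  shows "\<wp> (- z) = \<wp> z"
proof -
  have "- z \<notin> \<Lambda>"
    using assms uminus_lattice_iff by simp
  from DERIV_unique[OF wzeta_has_field_derivative[OF this]
      has_field_derivative_odd_fun[OF wzeta_minus wzeta_has_field_derivative[OF assms]]]
  show ?thesis
    by simp
qed

lemma wp_cnj:
  assumes "z \<notin> \<Lambda>"
  shows "\<wp> (cnj z) = cnj (\<wp> z)"
proof -
  have "cnj z \<notin> \<Lambda>"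
    using assms cnj_lattice_iff by simp
  from DERIV_unique[OF wzeta_has_field_derivative[OF this]
      has_field_derivative_cnj_symmetric[OF wzeta_cnj wzeta_has_field_derivative[OF assms]]]
  show ?thesis
    by simp
qed

definition zeta_term :: "int \<times> int \<Rightarrow> complex \<Rightarrow> complex" where
  "zeta_term p z = 1 / (z - lpoint p) + (if p = (0, 0) then 0 else 1 / lpoint p + z / (lpoint p)\<^sup>2)"

definition wp_term :: "int \<times> int \<Rightarrow> complex \<Rightarrow> complex" where
  "wp_term p z = 1 / (z - lpoint p)\<^sup>2 - (if p = (0, 0) then 0 else 1 / (lpoint p)\<^sup>2)"

definition zeta_shell :: "nat \<Rightarrow> complex \<Rightarrow> complex" where
  "zeta_shell k z = (\<Sum>p\<in>grid_shell k. zeta_term p z)"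

definition wp_shell :: "nat \<Rightarrow> complex \<Rightarrow> complex" where
  "wp_shell k z = (\<Sum>p\<in>grid_shell k. wp_term p z)"

lemma zeta_shell_0: "zeta_shell 0 z = 1 / z"
  by (simp add: zeta_shell_def grid_shell_0 zeta_term_def)

lemma wfactor_has_field_derivative:
  assumes "z \<noteq> lpoint p"
  shows "(wfactor p has_field_derivative wfactor p z * zeta_term p z) (at z)"
proof (cases "p = (0, 0)")
  case True
  with assms show ?thesis
    by (auto simp: wfactor_def[abs_def] zeta_term_def intro!: derivative_eq_intros)
next
  case False
  define \<omega> where "\<omega> = lpoint p"
  define E where "E = (\<lambda>z. exp (z / \<omega> + (z / \<omega>)\<^sup>2 / 2))"
  have \<omega>: "\<omega> \<noteq> 0" "z \<noteq> \<omega>"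
    using False assms by (simp_all add: \<omega>_def lpoint_eq_0_iff)
  have "wfactor p = (\<lambda>z. (1 - z / \<omega>) * E z)"
    using False by (simp add: wfactor_def[abs_def] weierstrass_factor_2 \<omega>_def E_def)
  moreover have "((\<lambda>z. (1 - z / \<omega>) * E z) has_field_derivative
      - (1 / \<omega>) * E z + (1 - z / \<omega>) * (E z * (1 / \<omega> + (z / \<omega>) * (1 / \<omega>)))) (at z)"
    using \<omega> unfolding E_def by (auto intro!: derivative_eq_intros simp: power2_eq_square field_simps)
  moreover have "- (1 / \<omega>) * E z + (1 - z / \<omega>) * (E z * (1 / \<omega> + (z / \<omega>) * (1 / \<omega>)))
      = (1 - z / \<omega>) * E z * zeta_term p z"
    using False \<omega> by (simp add: zeta_term_def \<omega>_def[symmetric] field_simps power2_eq_square)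
  ultimately show ?thesis
    by simp
qed

lemma zeta_term_has_field_derivative:
  assumes "z \<noteq> lpoint p"
  shows "(zeta_term p has_field_derivative - wp_term p z) (at z)"
  using assms lpoint_eq_0_iff[of p]
  by (auto simp: zeta_term_def[abs_def] wp_term_def power2_eq_square field_simps
      intro!: derivative_eq_intros)

lemma zeta_shell_has_field_derivative:
  assumes "\<And>p. p \<in> grid_shell k \<Longrightarrow> z \<noteq> lpoint p"
  shows "(zeta_shell k has_field_derivative - wp_shell k z) (at z)"
  unfolding zeta_shell_def[abs_def] wp_shell_def sum_negf[symmetric]
  by (intro DERIV_sum zeta_term_has_field_derivative assms)

lemma logderiv_shell_factor:
  assumes "z \<notin> \<Lambda>"
  shows "deriv (shell_factor k) z / shell_factor k z = zeta_shell k z"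
proof -
  have nz: "wfactor p z \<noteq> 0" "z \<noteq> lpoint p" for p
    using assms lpoint_in_lattice[of p] by (auto simp: wfactor_eq_0_iff)
  have "(shell_factor k has_field_derivative
      shell_factor k z * (\<Sum>p\<in>grid_shell k. wfactor p z * zeta_term p z / wfactor p z)) (at z)"
    unfolding shell_factor_def[abs_def]
    by (rule has_field_derivative_prod') (use nz wfactor_has_field_derivative in auto)
  moreover have "shell_factor k z \<noteq> 0"
    using nz by (simp add: shell_factor_def)
  ultimately show ?thesis
    using nz by (simp add: DERIV_imp_deriv zeta_shell_def)
qed

lemma wzeta_sums:
  assumes "z \<notin> \<Lambda>"
  shows "(\<lambda>k. zeta_shell k z) sums \<zeta> z"
proof -
  have "(\<lambda>k. deriv (shell_factor k) z / shell_factor k z) sums (deriv \<sigma> z / \<sigma> z)"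
  proof (rule logderiv_prodinf_complex_uniform_limit)
    show "uniform_limit (ball 0 (norm z + 1)) (\<lambda>n x. \<Prod>k<n. shell_factor k x) \<sigma> sequentially"
      by (rule uniform_limit_on_subset[OF shell_products_uniform_limit[of "norm z + 1"]]) auto
  qed (use assms in \<open>auto simp: wsigma_eq_0_iff intro: holomorphic_intros\<close>)
  then show ?thesis
    using logderiv_shell_factor[OF assms] by (simp add: wzeta_def)
qed

lemma zeta_term_eq:
  assumes "p \<noteq> (0, 0)" "z \<noteq> lpoint p"
  shows "zeta_term p z = z\<^sup>2 / ((lpoint p)\<^sup>2 * (z - lpoint p))"
  using assms lpoint_eq_0_iff[of p]
  by (simp add: zeta_term_def field_simps power2_eq_square)

lemma norm_zeta_term_le:
  assumes p: "p \<in> grid_shell k" and k: "k \<noteq> 0" and z: "norm z < R" and R: "R \<le> gap * k"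
  shows "norm (zeta_term p z) \<le> R\<^sup>2 / (4 * gap ^ 3 * real k ^ 3)"
proof -
  define \<omega> where "\<omega> = lpoint p"
  have p0: "p \<noteq> (0, 0)"
    using p k by (auto simp: grid_shell_def shell_index_def)
  have pos: "0 < 2 * gap * k"
    using gap_pos k by simp
  have lp: "2 * gap * k \<le> norm \<omega>"
    using norm_lpoint_ge[of p] p by (simp add: grid_shell_def \<omega>_def)
  have "norm \<omega> - norm z \<le> norm (z - \<omega>)"
    by (metis norm_minus_commute norm_triangle_ineq2)
  then have dist: "norm \<omega> / 2 \<le> norm (z - \<omega>)"
    using lp R z by simp
  have "0 < norm \<omega>"
    using lp pos by linarith
  with dist have "z \<noteq> \<omega>"
    by auto
  then have "norm (zeta_term p z) = norm z ^ 2 / (norm \<omega> ^ 2 * norm (z - \<omega>))"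
    using zeta_term_eq[OF p0] by (simp add: \<omega>_def norm_divide norm_mult norm_power)
  also have "\<dots> \<le> R ^ 2 / (norm \<omega> ^ 2 * (norm \<omega> / 2))"
    using dist z \<open>0 < norm \<omega>\<close> by (intro frac_le mult_left_mono power_mono mult_pos_pos) auto
  also have "\<dots> = 2 * R ^ 2 / norm \<omega> ^ 3"
    by (simp add: power3_eq_cube power2_eq_square)
  also have "\<dots> \<le> 2 * R ^ 2 / (2 * gap * k) ^ 3"
    using lp pos by (intro divide_left_mono power_mono mult_pos_pos) auto
  also have "\<dots> = R\<^sup>2 / (4 * gap ^ 3 * real k ^ 3)"
    by (simp add: power3_eq_cube)
  finally show ?thesis .
qed

lemma norm_zeta_shell_le:
  assumes z: "norm z < R" and k: "k \<noteq> 0" and R: "R \<le> gap * k"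
  shows "norm (zeta_shell k z) \<le> 2 * R\<^sup>2 / (gap ^ 3 * (real k)\<^sup>2)"
proof -
  have "norm (zeta_shell k z) \<le> (\<Sum>p\<in>grid_shell k. norm (zeta_term p z))"
    unfolding zeta_shell_def by (rule norm_sum)
  also have "\<dots> \<le> card (grid_shell k) * (R\<^sup>2 / (4 * gap ^ 3 * real k ^ 3))"
    using norm_zeta_term_le[OF _ k z R] by (intro sum_bounded_above) auto
  also have "\<dots> = 2 * R\<^sup>2 / (gap ^ 3 * (real k)\<^sup>2)"
    using k gap_pos by (simp add: card_grid_shell field_simps power3_eq_cube power2_eq_square)
  finally show ?thesis .
qed

lemma zeta_shell_tail:
  assumes R: "0 < R" and K: "K \<noteq> 0" "R \<le> gap * K"
  obtains g g' where "\<And>z. z \<in> ball 0 R \<Longrightarrow> (\<lambda>n. zeta_shell (n + K) z) sums g z \<and>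
    (\<lambda>n. - wp_shell (n + K) z) sums g' z \<and> (g has_field_derivative g' z) (at z)"
proof -
  have far: "R \<le> gap * real (n + K)" for n
  proof -
    have "gap * K \<le> gap * real (n + K)"
      using gap_pos by (intro mult_left_mono) auto
    with K(2) show ?thesis
      by linarith
  qed
  show ?thesis
  proof (rule series_and_derivative_comparison[OF open_ball])
    show "summable (\<lambda>n. 2 * R\<^sup>2 / gap ^ 3 / (real (n + K))\<^sup>2)"
      using summable_const_div_square[of "2 * R\<^sup>2 / gap ^ 3"]
        summable_iff_shift[of "\<lambda>n. 2 * R\<^sup>2 / gap ^ 3 / (real n)\<^sup>2" K]
      by simp
    show "(zeta_shell (n + K) has_field_derivative - wp_shell (n + K) z) (at z)"
      if "z \<in> ball 0 R" for n z
    proof (rule zeta_shell_has_field_derivative)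
      fix p assume p: "p \<in> grid_shell (n + K)"
      have "2 * R \<le> norm (lpoint p)"
        using norm_lpoint_ge[of p] far[of n] p by (simp add: grid_shell_def)
      then show "z \<noteq> lpoint p"
        using that R by auto
    qed
    show "\<forall>\<^sub>F n in sequentially. \<forall>z\<in>ball 0 R.
        norm (zeta_shell (n + K) z) \<le> 2 * R\<^sup>2 / gap ^ 3 / (real (n + K))\<^sup>2"
    proof (intro always_eventually allI ballI)
      fix n and z :: complex
      assume "z \<in> ball 0 R"
      then have "norm (zeta_shell (n + K) z) \<le> 2 * R\<^sup>2 / (gap ^ 3 * (real (n + K))\<^sup>2)"
        using K(1) by (intro norm_zeta_shell_le far) auto
      then show "norm (zeta_shell (n + K) z) \<le> 2 * R\<^sup>2 / gap ^ 3 / (real (n + K))\<^sup>2"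
        by (simp add: divide_divide_eq_left)
    qed
  qed (use that in blast)
qed

lemma wp_sums:
  assumes z: "z \<notin> \<Lambda>"
  shows "(\<lambda>k. wp_shell k z) sums \<wp> z"
proof -
  define R where "R = norm z + 1"
  have R: "0 < R"
    by (simp add: R_def add_nonneg_pos)
  obtain K :: nat where K: "K \<noteq> 0" "R \<le> gap * K"
    by (rule obtain_gap_mult_ge[of R])
  obtain g g' where gg: "\<And>y. y \<in> ball 0 R \<Longrightarrow> (\<lambda>n. zeta_shell (n + K) y) sums g y \<and>
      (\<lambda>n. - wp_shell (n + K) y) sums g' y \<and> (g has_field_derivative g' y) (at y)"
    using zeta_shell_tail[OF R K] by blast
  define S where "S = ball 0 R \<inter> - \<Lambda>"
  have S: "open S" "z \<in> S"
    using z by (simp_all add: S_def R_def open_Int open_lattice_complement)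
  have eq: "\<zeta> y = (\<Sum>k<K. zeta_shell k y) + g y" if "y \<in> S" for y
  proof -
    have "(\<lambda>k. zeta_shell k y) sums (g y + (\<Sum>k<K. zeta_shell k y))"
      using gg[of y] that sums_iff_shift[of "\<lambda>k. zeta_shell k y" K] by (auto simp: S_def)
    moreover have "(\<lambda>k. zeta_shell k y) sums \<zeta> y"
      using that by (intro wzeta_sums) (simp add: S_def)
    ultimately show ?thesis
      by (simp add: sums_unique2 add.commute)
  qed
  have "((\<lambda>y. (\<Sum>k<K. zeta_shell k y) + g y) has_field_derivative
      (\<Sum>k<K. - wp_shell k z) + g' z) (at z)"
  proof (intro DERIV_add DERIV_sum)
    show "(zeta_shell k has_field_derivative - wp_shell k z) (at z)" for k
      using z lpoint_in_lattice by (intro zeta_shell_has_field_derivative) auto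
    show "(g has_field_derivative g' z) (at z)"
      using gg[of z] S by (simp add: S_def)
  qed
  then have "(\<zeta> has_field_derivative (\<Sum>k<K. - wp_shell k z) + g' z) (at z)"
    by (rule has_field_derivative_transform_within_open[OF _ S]) (simp add: eq)
  then have "- \<wp> z = (\<Sum>k<K. - wp_shell k z) + g' z"
    by (rule DERIV_unique[OF wzeta_has_field_derivative[OF z]])
  moreover have "(\<lambda>k. - wp_shell k z) sums (g' z + (\<Sum>k<K. - wp_shell k z))"
    using gg[of z] S sums_iff_shift[of "\<lambda>k. - wp_shell k z" K] by (simp add: S_def)
  ultimately have "(\<lambda>k. - wp_shell k z) sums - \<wp> z"
    by (simp only: add.commute)
  from sums_minus[OF this] show ?thesis
    by simp
qed

lemma wzeta_principal_part:
  assumes S: "open S" "S \<subseteq> ball 0 R" "S \<inter> \<Lambda> \<subseteq> {0}" and R: "0 < R"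
  obtains G where "G holomorphic_on S" "\<And>z. z \<in> S - {0} \<Longrightarrow> \<zeta> z = 1 / z + G z"
proof -
  obtain K :: nat where K: "K \<noteq> 0" "R \<le> gap * K"
    by (rule obtain_gap_mult_ge[of R])
  obtain g g' where gg: "\<And>y. y \<in> ball 0 R \<Longrightarrow> (\<lambda>n. zeta_shell (n + K) y) sums g y \<and>
      (\<lambda>n. - wp_shell (n + K) y) sums g' y \<and> (g has_field_derivative g' y) (at y)"
    using zeta_shell_tail[OF R K] by blast
  define G where "G y = (\<Sum>k\<in>{1..<K}. zeta_shell k y) + g y" for y
  have "G holomorphic_on S"
    unfolding holomorphic_on_open[OF S(1)]
  proof safe
    fix y assume y: "y \<in> S"
    have "(zeta_shell k has_field_derivative - wp_shell k y) (at y)" if "k \<in> {1..<K}" for k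
    proof (rule zeta_shell_has_field_derivative)
      fix p assume "p \<in> grid_shell k"
      then have "lpoint p \<noteq> 0"
        using that by (auto simp: grid_shell_def lpoint_eq_0_iff shell_index_def)
      then show "y \<noteq> lpoint p"
        using S(3) y lpoint_in_lattice[of p] by auto
    qed
    then have "((\<lambda>y. (\<Sum>k\<in>{1..<K}. zeta_shell k y) + g y) has_field_derivative
        (\<Sum>k\<in>{1..<K}. - wp_shell k y) + g' y) (at y)"
      using gg[of y] y S(2) by (intro DERIV_add DERIV_sum) auto
    then show "\<exists>G'. (G has_field_derivative G') (at y)"
      unfolding G_def[abs_def] by blast
  qed
  moreover have "\<zeta> z = 1 / z + G z" if z: "z \<in> S - {0}" for z
  proof -
    have "(\<lambda>k. zeta_shell k z) sums (g z + (\<Sum>k<K. zeta_shell k z))"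
      using gg[of z] z S(2) sums_iff_shift[of "\<lambda>k. zeta_shell k z" K] by auto
    then have "\<zeta> z = g z + (\<Sum>k<K. zeta_shell k z)"
      using wzeta_sums[of z] z S(3) sums_unique2 by blast
    also have "(\<Sum>k<K. zeta_shell k z) = zeta_shell 0 z + (\<Sum>k\<in>{1..<K}. zeta_shell k z)"
      using K(1) by (simp add: atLeast1_lessThan_eq_remove0 sum.remove)
    finally show ?thesis
      by (simp add: G_def zeta_shell_0)
  qed
  ultimately show ?thesis
    using that by blast
qed

end

section \<open>Periodicity of wp and quasi-periodicity of zeta and sigma\<close>

lemma sum_reindex_diff:
  fixes f :: "'a \<Rightarrow> 'b::ab_group_add"
  assumes "finite B" "inj_on h B"
  shows "(\<Sum>x\<in>B. f (h x)) - (\<Sum>x\<in>B. f x) = (\<Sum>x\<in>h ` B - B. f x) - (\<Sum>x\<in>B - h ` B. f x)"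
proof -
  have "(\<Sum>x\<in>B. f (h x)) = (\<Sum>x\<in>h ` B. f x)"
    using sum.reindex[OF assms(2), of f] by simp
  also have "\<dots> = (\<Sum>x\<in>h ` B \<inter> B. f x) + (\<Sum>x\<in>h ` B - B. f x)"
    using assms(1) by (intro sum.Int_Diff) simp
  finally have "(\<Sum>x\<in>B. f (h x)) = (\<Sum>x\<in>h ` B \<inter> B. f x) + (\<Sum>x\<in>h ` B - B. f x)" .
  moreover have "(\<Sum>x\<in>B. f x) = (\<Sum>x\<in>h ` B \<inter> B. f x) + (\<Sum>x\<in>B - h ` B. f x)"
    using sum.Int_Diff[OF assms(1), of f "h ` B"] by (simp add: Int_commute)
  ultimately show ?thesis
    by simp
qed

context rect_lattice
begin

lemma wp_grid_sums_LIMSEQ: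
  assumes "z \<notin> \<Lambda>"
  shows "(\<lambda>N. \<Sum>p\<in>grid N. wp_term p z) \<longlonglongrightarrow> \<wp> z"
proof -
  have "(\<lambda>N. \<Sum>k<Suc N. wp_shell k z) \<longlonglongrightarrow> \<wp> z"
    using wp_sums[OF assms] unfolding sums_def by (rule LIMSEQ_Suc)
  then show ?thesis
    unfolding wp_shell_def sum_grid_shells .
qed

lemma norm_sum_inverse_square_le:
  fixes M N :: nat
  assumes Q: "Q \<subseteq> grid_shell M" and N: "N \<le> M" "N \<noteq> 0" "norm z \<le> gap * N"
  shows "norm (\<Sum>q\<in>Q. 1 / (z - lpoint q)\<^sup>2) \<le> 8 * M / (gap * N)\<^sup>2"
proof -
  have pos: "0 < gap * N"
    using N(2) gap_pos by simp
  have term_le: "norm (1 / (z - lpoint q)\<^sup>2) \<le> 1 / (gap * N)\<^sup>2" if "q \<in> Q" for q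
  proof -
    have "shell_index q = M"
      using that Q by (auto simp: grid_shell_def)
    then have "gap * N \<le> gap * shell_index q"
      using N(1) gap_pos by simp
    then have "2 * gap * N \<le> norm (lpoint q)"
      using norm_lpoint_ge[of q] by linarith
    moreover have "norm (lpoint q) - norm z \<le> norm (z - lpoint q)"
      by (metis norm_minus_commute norm_triangle_ineq2)
    ultimately have "gap * N \<le> norm (z - lpoint q)"
      using N(3) by linarith
    from power_mono[OF this less_imp_le[OF pos], of 2]
    have "1 / norm (z - lpoint q) ^ 2 \<le> 1 / (gap * N)\<^sup>2"
      using frac_le[of 1 1 "(gap * N)\<^sup>2" "norm (z - lpoint q) ^ 2"] pos gap_pos N(2) by simp
    then show ?thesis
      by (simp add: norm_divide norm_power)
  qed
  have "card Q \<le> 8 * M"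
    using card_mono[OF finite_grid_shell Q] card_grid_shell[of M] N(1,2) by simp
  have "norm (\<Sum>q\<in>Q. 1 / (z - lpoint q)\<^sup>2) \<le> (\<Sum>q\<in>Q. norm (1 / (z - lpoint q)\<^sup>2))"
    by (rule norm_sum)
  also have "\<dots> \<le> card Q * (1 / (gap * N)\<^sup>2)"
    using term_le by (intro sum_bounded_above) auto
  also have "\<dots> \<le> 8 * M * (1 / (gap * N)\<^sup>2)"
    using \<open>card Q \<le> 8 * M\<close> by (intro mult_right_mono) auto
  finally show ?thesis
    by simp
qed

lemma norm_wp_grid_sum_translate_le:
  assumes e: "\<bar>fst e\<bar> \<le> 1" "\<bar>snd e\<bar> \<le> 1" and N: "N \<noteq> 0" "norm z \<le> gap * N"
  shows "norm ((\<Sum>p\<in>grid N. wp_term p (z + lpoint e)) - (\<Sum>p\<in>grid N. wp_term p z))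
    \<le> 24 / (gap\<^sup>2 * N)"
proof -
  define h where "h = (\<lambda>p::int \<times> int. (fst p - fst e, snd p - snd e))"
  define A where "A q = 1 / (z - lpoint q)\<^sup>2" for q
  have "wp_term p (z + lpoint e) - wp_term p z = A (h p) - A p" for p
    by (simp add: wp_term_def A_def h_def lattice_point_diff[symmetric] algebra_simps)
  then have "(\<Sum>p\<in>grid N. wp_term p (z + lpoint e)) - (\<Sum>p\<in>grid N. wp_term p z)
      = (\<Sum>p\<in>grid N. A (h p)) - (\<Sum>p\<in>grid N. A p)"
    by (simp add: sum_subtractf[symmetric])
  also have "\<dots> = (\<Sum>q\<in>h ` grid N - grid N. A q) - (\<Sum>q\<in>grid N - h ` grid N. A q)"
    by (rule sum_reindex_diff) (auto simp: inj_on_def h_def prod_eq_iff)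
  finally have diff: "(\<Sum>p\<in>grid N. wp_term p (z + lpoint e)) - (\<Sum>p\<in>grid N. wp_term p z)
      = (\<Sum>q\<in>h ` grid N - grid N. A q) - (\<Sum>q\<in>grid N - h ` grid N. A q)" .
  note shells = grid_translate_diff_subset[OF e, of N, folded h_def]
  have "norm (\<Sum>q\<in>h ` grid N - grid N. A q) \<le> 8 * Suc N / (gap * N)\<^sup>2"
    unfolding A_def by (rule norm_sum_inverse_square_le[OF shells(1)]) (use N in auto)
  moreover have "norm (\<Sum>q\<in>grid N - h ` grid N. A q) \<le> 8 * N / (gap * N)\<^sup>2"
    unfolding A_def by (rule norm_sum_inverse_square_le[OF shells(2)]) (use N in auto)
  ultimately have "norm ((\<Sum>p\<in>grid N. wp_term p (z + lpoint e)) - (\<Sum>p\<in>grid N. wp_term p z))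
      \<le> 8 * Suc N / (gap * N)\<^sup>2 + 8 * N / (gap * N)\<^sup>2"
    unfolding diff by (smt (verit) norm_triangle_ineq4)
  also have "\<dots> = (16 * N + 8) / (gap * N)\<^sup>2"
    by (simp add: add_divide_distrib[symmetric] algebra_simps)
  also have "\<dots> \<le> 24 * N / (gap * N)\<^sup>2"
    using N by (intro divide_right_mono) auto
  also have "\<dots> = 24 / (gap\<^sup>2 * N)"
    using N gap_pos by (simp add: power2_eq_square field_simps)
  finally show ?thesis .
qed

lemma wp_add_lattice_point:
  assumes z: "z \<notin> \<Lambda>" and e: "\<bar>fst e\<bar> \<le> 1" "\<bar>snd e\<bar> \<le> 1"
  shows "\<wp> (z + lpoint e) = \<wp> z"
proof -
  define D where "D N = (\<Sum>p\<in>grid N. wp_term p (z + lpoint e)) - (\<Sum>p\<in>grid N. wp_term p z)" for N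
  have "z + lpoint e \<notin> \<Lambda>"
    using z add_lattice_iff[OF lpoint_in_lattice] by simp
  then have "D \<longlonglongrightarrow> \<wp> (z + lpoint e) - \<wp> z"
    unfolding D_def[abs_def] using z by (intro tendsto_diff wp_grid_sums_LIMSEQ)
  moreover have "D \<longlonglongrightarrow> 0"
  proof (rule Lim_null_comparison)
    show "\<forall>\<^sub>F N in sequentially. norm (D N) \<le> 24 / (gap\<^sup>2 * N)"
      using eventually_gap_mult_ge[of "norm z"]
      by eventually_elim (auto simp: D_def intro: norm_wp_grid_sum_translate_le[OF e])
    show "(\<lambda>N. 24 / (gap\<^sup>2 * real N)) \<longlonglongrightarrow> 0"
      using lim_const_over_n[of "24 / gap\<^sup>2"] by simp
  qed
  ultimately have "\<wp> (z + lpoint e) - \<wp> z = 0"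
    by (rule LIMSEQ_unique)
  then show ?thesis
    by simp
qed

lemma wp_add_2w: "z \<notin> \<Lambda> \<Longrightarrow> \<wp> (z + 2 * w) = \<wp> z"
  using wp_add_lattice_point[of z "(1, 0)"] by (simp add: two_w_eq_lpoint)

lemma wp_add_2w': "z \<notin> \<Lambda> \<Longrightarrow> \<wp> (z + 2 * w') = \<wp> z"
  using wp_add_lattice_point[of z "(0, 1)"] by (simp add: two_w'_eq_lpoint)

lemma constant_on_lattice_complement:
  assumes "\<And>z. z \<notin> \<Lambda> \<Longrightarrow> (f has_field_derivative 0) (at z)"
  shows "f constant_on - \<Lambda>"
  using assms
  by (intro has_field_derivative_0_imp_constant_on connected_lattice_complement
      open_lattice_complement) auto

lemma wzeta_add_period:
  assumes P: "P \<in> \<Lambda>" "P / 2 \<notin> \<Lambda>" and per: "\<And>z. z \<notin> \<Lambda> \<Longrightarrow> \<wp> (z + P) = \<wp> z"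
    and z: "z \<notin> \<Lambda>"
  shows "\<zeta> (z + P) = \<zeta> z + 2 * \<zeta> (P / 2)"
proof -
  have "((\<lambda>z. \<zeta> (z + P) - \<zeta> z) has_field_derivative 0) (at x)" if x: "x \<notin> \<Lambda>" for x
  proof -
    have xP: "x + P \<notin> \<Lambda>"
      using x add_lattice_iff[OF P(1)] by simp
    have "((\<lambda>z. \<zeta> (z + P)) has_field_derivative - \<wp> (x + P) * 1) (at x)"
      by (rule DERIV_chain'[of "\<lambda>z. z + P" 1 x UNIV \<zeta>])
         (auto intro!: derivative_eq_intros wzeta_has_field_derivative xP)
    from DERIV_diff[OF this wzeta_has_field_derivative[OF x]] show ?thesis
      using per[OF x] by simp
  qed
  then have "(\<lambda>z. \<zeta> (z + P) - \<zeta> z) constant_on - \<Lambda>"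
    by (rule constant_on_lattice_complement)
  then obtain c where c: "\<And>z. z \<notin> \<Lambda> \<Longrightarrow> \<zeta> (z + P) - \<zeta> z = c"
    by (auto simp: constant_on_def)
  have "- (P / 2) \<notin> \<Lambda>"
    using P(2) uminus_lattice_iff by simp
  from c[OF this] have "c = 2 * \<zeta> (P / 2)"
    by (simp add: wzeta_minus)
  with c[OF z] show ?thesis
    by (simp add: algebra_simps)
qed

lemma wsigma_translate_ratio_has_derivative_0:
  assumes P: "P \<in> \<Lambda>" "P / 2 \<notin> \<Lambda>" and per: "\<And>z. z \<notin> \<Lambda> \<Longrightarrow> \<wp> (z + P) = \<wp> z"
    and x: "x \<notin> \<Lambda>"
  shows "((\<lambda>z. \<sigma> (z + P) * exp (- 2 * \<zeta> (P / 2) * z) / \<sigma> z) has_field_derivative 0) (at x)"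
proof -
  define \<eta> where "\<eta> = \<zeta> (P / 2)"
  have xP: "x + P \<notin> \<Lambda>"
    using x add_lattice_iff[OF P(1)] by simp
  have "((\<lambda>z. \<sigma> (z + P)) has_field_derivative deriv \<sigma> (x + P) * 1) (at x)"
    by (rule DERIV_chain'[of "\<lambda>z. z + P" 1 x UNIV \<sigma>])
       (auto intro!: derivative_eq_intros wsigma_has_field_derivative)
  moreover have "((\<lambda>z. exp (- 2 * \<eta> * z)) has_field_derivative exp (- 2 * \<eta> * x) * (- 2 * \<eta> * 1))
      (at x)"
    by (auto intro!: derivative_eq_intros)
  ultimately have "((\<lambda>z. \<sigma> (z + P) * exp (- 2 * \<eta> * z)) has_field_derivative
      \<sigma> (x + P) * (exp (- 2 * \<eta> * x) * (- 2 * \<eta> * 1)) + deriv \<sigma> (x + P) * 1 * exp (- 2 * \<eta> * x))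
      (at x)"
    by (rule DERIV_mult')
  from DERIV_divide[OF this wsigma_has_field_derivative] x
  have "((\<lambda>z. \<sigma> (z + P) * exp (- 2 * \<eta> * z) / \<sigma> z) has_field_derivative
      ((\<sigma> (x + P) * (exp (- 2 * \<eta> * x) * (- 2 * \<eta> * 1)) + deriv \<sigma> (x + P) * 1 * exp (- 2 * \<eta> * x))
        * \<sigma> x - \<sigma> (x + P) * exp (- 2 * \<eta> * x) * deriv \<sigma> x) / (\<sigma> x * \<sigma> x)) (at x)"
    by (simp add: wsigma_eq_0_iff)
  moreover have "deriv \<sigma> (x + P) = \<sigma> (x + P) * (\<zeta> x + 2 * \<eta>)"
    using deriv_wsigma_eq[OF xP] wzeta_add_period[OF P per x] by (simp add: \<eta>_def)
  moreover have "deriv \<sigma> x = \<sigma> x * \<zeta> x"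
    using deriv_wsigma_eq[OF x] .
  ultimately show ?thesis
    by (simp add: \<eta>_def algebra_simps)
qed

lemma wsigma_add_period:
  assumes P: "P \<in> \<Lambda>" "P / 2 \<notin> \<Lambda>" and per: "\<And>z. z \<notin> \<Lambda> \<Longrightarrow> \<wp> (z + P) = \<wp> z"
  shows "\<sigma> (z + P) = - exp (2 * \<zeta> (P / 2) * (z + P / 2)) * \<sigma> z"
proof (cases "z \<in> \<Lambda>")
  case True
  then have "\<sigma> z = 0" "\<sigma> (z + P) = 0"
    using add_lattice_iff[OF P(1), of z] by (simp_all add: wsigma_eq_0_iff)
  then show ?thesis
    by simp
next
  case False
  define \<eta> where "\<eta> = \<zeta> (P / 2)"
  define Q where "Q z = \<sigma> (z + P) * exp (- 2 * \<eta> * z) / \<sigma> z" for z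
  have "Q constant_on - \<Lambda>"
    unfolding Q_def[abs_def] \<eta>_def
    by (intro constant_on_lattice_complement wsigma_translate_ratio_has_derivative_0[OF P per])
  then obtain d where d: "\<And>z. z \<notin> \<Lambda> \<Longrightarrow> Q z = d"
    by (auto simp: constant_on_def)
  have "- (P / 2) \<notin> \<Lambda>"
    using P(2) uminus_lattice_iff by simp
  from d[OF this] have "d = - exp (\<eta> * P)"
    using P(2) by (simp add: Q_def wsigma_minus wsigma_eq_0_iff field_simps)
  with d[OF False] False have "\<sigma> (z + P) * exp (- 2 * \<eta> * z) = - exp (\<eta> * P) * \<sigma> z"
    by (simp add: Q_def wsigma_eq_0_iff field_simps)
  then have "\<sigma> (z + P) = - exp (\<eta> * P) * exp (2 * \<eta> * z) * \<sigma> z"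
    by (simp add: exp_minus field_simps)
  then show ?thesis
    by (simp add: \<eta>_def exp_add[symmetric] algebra_simps)
qed

lemma two_w_in_lattice: "2 * w \<in> \<Lambda>" and two_w'_in_lattice: "2 * w' \<in> \<Lambda>"
  by (simp_all add: two_w_eq_lpoint two_w'_eq_lpoint lpoint_in_lattice)

lemma wzeta_add_2w: "z \<notin> \<Lambda> \<Longrightarrow> \<zeta> (z + 2 * w) = \<zeta> z + 2 * \<zeta> w"
  using wzeta_add_period[OF two_w_in_lattice _ wp_add_2w] w_notin_lattice by simp

lemma wzeta_add_2w': "z \<notin> \<Lambda> \<Longrightarrow> \<zeta> (z + 2 * w') = \<zeta> z + 2 * \<zeta> w'"
  using wzeta_add_period[OF two_w'_in_lattice _ wp_add_2w'] w'_notin_lattice by simp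

lemma wsigma_add_2w: "\<sigma> (z + 2 * w) = - exp (2 * \<zeta> w * (z + w)) * \<sigma> z"
  using wsigma_add_period[OF two_w_in_lattice _ wp_add_2w] w_notin_lattice by simp

lemma wsigma_add_2w': "\<sigma> (z + 2 * w') = - exp (2 * \<zeta> w' * (z + w')) * \<sigma> z"
  using wsigma_add_period[OF two_w'_in_lattice _ wp_add_2w'] w'_notin_lattice by simp

end

section \<open>Legendre's relation\<close>

lemma has_contour_integral_linepath_translate:
  assumes "((\<lambda>z. f (z + d)) has_contour_integral I) (linepath a b)"
  shows "(f has_contour_integral I) (linepath (a + d) (b + d))"
proof -
  have "linepath (a + d) (b + d) t = linepath a b t + d" for t
    by (simp add: linepath_def algebra_simps scaleR_conv_of_real)
  with assms show ?thesis
    unfolding has_contour_integral_linepath by simp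
qed

lemma has_contour_integral_linepath_quasi_periodic:
  assumes I: "(f has_contour_integral I) (linepath a b)"
    and f: "\<And>z. z \<in> closed_segment a b \<Longrightarrow> f (z + P) = f z + c"
  shows "(f has_contour_integral I + c * (b - a)) (linepath (a + P) (b + P))"
proof (rule has_contour_integral_linepath_translate)
  have "((\<lambda>z. f z + c) has_contour_integral I + c * (b - a)) (linepath a b)"
    by (intro has_contour_integral_add I has_contour_integral_const_linepath)
  then show "((\<lambda>z. f (z + P)) has_contour_integral I + c * (b - a)) (linepath a b)"
    by (rule has_contour_integral_eq) (simp add: f)
qed

lemma has_contour_integral_rectpath_simple_pole:
  assumes G: "G holomorphic_on S" and S: "convex S" "cbox a b \<subseteq> S" and zero: "0 \<in> box a b"
    and f: "\<And>z. z \<in> S - {0} \<Longrightarrow> f z = 1 / z + G z"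
  shows "(f has_contour_integral 2 * pi * \<i>) (rectpath a b)"
proof -
  have le: "Re a \<le> Re b" "Im a \<le> Im b"
    using zero by (auto simp: in_box_complex_iff)
  have image_S: "path_image (rectpath a b) \<subseteq> S"
    using path_image_rectpath_subset_cbox[OF le] S(2) by blast
  have zero_image: "0 \<notin> path_image (rectpath a b)"
    using path_image_rectpath_inter_box[OF le] zero by blast
  have "((\<lambda>z. 1 / (z - 0)) has_contour_integral 2 * pi * \<i> * 1) (rectpath a b)"
    using has_contour_integral_winding_number[OF valid_path_rectpath zero_image]
      winding_number_rectpath[OF zero] by simp
  moreover have "(G has_contour_integral 0) (rectpath a b)"
    using image_S by (intro Cauchy_theorem_convex_simple[OF G S(1)]) auto
  ultimately have "((\<lambda>z. 1 / (z - 0) + G z) has_contour_integral 2 * pi * \<i>) (rectpath a b)"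
    using has_contour_integral_add by fastforce
  then show ?thesis
  proof (rule has_contour_integral_eq)
    fix z assume "z \<in> path_image (rectpath a b)"
    then have "z \<in> S - {0}"
      using image_S zero_image by auto
    then show "1 / (z - 0) + G z = f z"
      using f by simp
  qed
qed

context rect_lattice
begin

lemma not_in_lattice_if_abs_Re: "\<bar>Re z\<bar> = Re w \<Longrightarrow> z \<notin> \<Lambda>"
  using not_in_lattice_ReI[of 0 z] not_in_lattice_ReI[of "- 1" z] w_pos by (cases "0 \<le> Re z") auto

lemma not_in_lattice_if_abs_Im: "\<bar>Im z\<bar> = Im w' \<Longrightarrow> z \<notin> \<Lambda>"
  using not_in_lattice_ImI[of 0 z] not_in_lattice_ImI[of "- 1" z] w'_pos by (cases "0 \<le> Im z") auto

lemma closed_segment_same_Re_inter_lattice: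
  "Re a = Re b \<Longrightarrow> \<bar>Re a\<bar> = Re w \<Longrightarrow> closed_segment a b \<inter> \<Lambda> = {}"
  using not_in_lattice_if_abs_Re by (auto simp: closed_segment_same_Re)

lemma closed_segment_same_Im_inter_lattice:
  "Im a = Im b \<Longrightarrow> \<bar>Im a\<bar> = Im w' \<Longrightarrow> closed_segment a b \<inter> \<Lambda> = {}"
  using not_in_lattice_if_abs_Im by (auto simp: closed_segment_same_Im)

lemma box_inter_lattice_subset:
  assumes "0 < e" "e < gap"
  shows "box (- (w + w') - Complex e e) (w + w' + Complex e e) \<inter> \<Lambda> \<subseteq> {0}"
proof
  fix z assume z: "z \<in> box (- (w + w') - Complex e e) (w + w' + Complex e e) \<inter> \<Lambda>"
  then obtain p where p: "z = lpoint p"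
    unfolding wlattice_eq_range by blast
  have "\<bar>of_int (fst p)\<bar> * (2 * Re w) < Re w + e" "\<bar>of_int (snd p)\<bar> * (2 * Im w') < Im w' + e"
    using z w_real w'_imag w_pos w'_pos
    by (auto simp: p in_box_complex_iff Re_lpoint Im_lpoint abs_mult abs_less_iff mult_ac)
  moreover have "Re w + e < 1 * (2 * Re w)" "Im w' + e < 1 * (2 * Im w')"
    using assms by (auto simp: gap_def)
  ultimately have "\<bar>of_int (fst p)\<bar> * (2 * Re w) < 1 * (2 * Re w)"
    "\<bar>of_int (snd p)\<bar> * (2 * Im w') < 1 * (2 * Im w')"
    by linarith+
  then have "\<bar>of_int (fst p) :: real\<bar> < 1" "\<bar>of_int (snd p) :: real\<bar> < 1"
    using w_pos w'_pos by (simp_all only: mult_less_cancel_right)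
  then have "\<bar>fst p\<bar> < 1" "\<bar>snd p\<bar> < 1"
    by (simp_all flip: of_int_abs)
  then have "p = (0, 0)"
    by (simp add: prod_eq_iff)
  then show "z \<in> {0}"
    by (simp add: p)
qed

lemma wzeta_has_contour_integral_rectpath:
  "(\<zeta> has_contour_integral 2 * pi * \<i>) (rectpath (- (w + w')) (w + w'))"
proof -
  define e where "e = gap / 2"
  have e: "0 < e" "e < gap"
    using gap_pos by (simp_all add: e_def)
  define S where "S = box (- (w + w') - Complex e e) (w + w' + Complex e e)"
  define R where "R = Re w + Im w' + 2 * e + 1"
  have SR: "S \<subseteq> ball 0 R"
  proof
    fix z assume "z \<in> S"
    then have "\<bar>Re z\<bar> < Re w + e" "\<bar>Im z\<bar> < Im w' + e"
      using w_real w'_imag by (auto simp: S_def in_box_complex_iff)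
    with cmod_le[of z] show "z \<in> ball 0 R"
      by (simp add: R_def)
  qed
  have "0 < R"
    using e w_pos w'_pos by (simp add: R_def)
  then obtain G where G: "G holomorphic_on S" "\<And>z. z \<in> S - {0} \<Longrightarrow> \<zeta> z = 1 / z + G z"
    using wzeta_principal_part[OF _ SR box_inter_lattice_subset[OF e, folded S_def]]
    by (auto simp: S_def open_box)
  show ?thesis
  proof (rule has_contour_integral_rectpath_simple_pole[OF G(1) _ _ _ G(2)])
    show "convex S"
      by (simp add: S_def convex_box)
    show "cbox (- (w + w')) (w + w') \<subseteq> S"
      using e w_real w'_imag by (auto simp: S_def in_cbox_complex_iff in_box_complex_iff)
    show "0 \<in> box (- (w + w')) (w + w')"
      using w_pos w'_pos w_real w'_imag by (simp add: in_box_complex_iff)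
  qed
qed

lemma legendre_relation: "\<zeta> w * w' - \<zeta> w' * w = pi * \<i> / 2"
proof -
  define a1 a2 a3 a4 where "a1 = - (w + w')" and "a2 = w - w'" and "a3 = w + w'" and "a4 = w' - w"
  have corners: "Re a1 = - Re w" "Im a1 = - Im w'" "Re a2 = Re w" "Im a2 = - Im w'"
    "Re a3 = Re w" "Im a3 = Im w'" "Re a4 = - Re w" "Im a4 = Im w'"
    using w_real w'_imag by (simp_all add: a1_def a2_def a3_def a4_def)
  have rect: "rectpath a1 a3 = linepath a1 a2 +++ linepath a2 a3 +++ linepath a3 a4 +++ linepath a4 a1"
  proof -
    have "Complex (Re a3) (Im a1) = a2" "Complex (Re a1) (Im a3) = a4"
      using corners by (simp_all add: complex_eq_iff)
    then show ?thesis
      by (simp add: rectpath_def Let_def)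
  qed
  have shifts: "a1 + 2 * w' = a4" "a2 + 2 * w' = a3" "a1 + 2 * w = a2" "a4 + 2 * w = a3"
    by (simp_all add: a1_def a2_def a3_def a4_def)
  have sides: "closed_segment a1 a2 \<inter> \<Lambda> = {}" "closed_segment a2 a3 \<inter> \<Lambda> = {}"
    "closed_segment a3 a4 \<inter> \<Lambda> = {}" "closed_segment a4 a1 \<inter> \<Lambda> = {}"
    using corners w_pos w'_pos
    by (simp_all add: closed_segment_same_Re_inter_lattice closed_segment_same_Im_inter_lattice)
  define I where "I a b = contour_integral (linepath a b) \<zeta>" for a b
  have has_I: "closed_segment a b \<inter> \<Lambda> = {} \<Longrightarrow> (\<zeta> has_contour_integral I a b) (linepath a b)" for a b
    unfolding I_def
    by (intro has_contour_integral_integral contour_integrable_continuous_linepath continuous_on_wzeta)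
  have "(\<zeta> has_contour_integral I a1 a2 + (I a2 a3 + (I a3 a4 + I a4 a1))) (rectpath a1 a3)"
    unfolding rect using sides by (intro has_contour_integral_join has_I valid_path_join) auto
  then have total: "I a1 a2 + (I a2 a3 + (I a3 a4 + I a4 a1)) = 2 * pi * \<i>"
    using wzeta_has_contour_integral_rectpath[folded a1_def a3_def] by (rule has_contour_integral_unique)
  have "(\<zeta> has_contour_integral I a1 a2 + 2 * \<zeta> w' * (a2 - a1)) (linepath a4 a3)"
    unfolding shifts(1,2)[symmetric] using sides(1)
    by (intro has_contour_integral_linepath_quasi_periodic has_I wzeta_add_2w') auto
  then have "(\<zeta> has_contour_integral - (I a1 a2 + 2 * \<zeta> w' * (a2 - a1))) (linepath a3 a4)"
    by (rule has_contour_integral_reverse_linepath)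
  then have top: "I a3 a4 = - (I a1 a2 + 2 * \<zeta> w' * (a2 - a1))"
    using has_I[OF sides(3)] has_contour_integral_unique by blast
  have "(\<zeta> has_contour_integral - I a4 a1) (linepath a1 a4)"
    using has_I[OF sides(4)] by (rule has_contour_integral_reverse_linepath)
  then have "(\<zeta> has_contour_integral - I a4 a1 + 2 * \<zeta> w * (a4 - a1)) (linepath a2 a3)"
    unfolding shifts(3,4)[symmetric] using sides(4)
    by (intro has_contour_integral_linepath_quasi_periodic wzeta_add_2w)
      (auto simp: closed_segment_commute)
  then have right: "I a2 a3 = - I a4 a1 + 2 * \<zeta> w * (a4 - a1)"
    using has_I[OF sides(2)] has_contour_integral_unique by blast
  have "4 * (\<zeta> w * w' - \<zeta> w' * w) = 4 * (pi * \<i> / 2)"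
    using total unfolding top right by (simp add: a1_def a2_def a3_def a4_def algebra_simps)
  then show ?thesis
    by (simp only: mult_cancel_left) simp
qed

end

section \<open>The functions Psi, v and p\<close>

lemma quasi_factor_ratio:
  fixes A B C X Y E :: complex
  shows "(- exp X * A) / (B * (- exp Y * C)) * exp E = A / (B * C) * exp (X - Y + E)"
  by (cases "B = 0 \<or> C = 0") (auto simp: exp_diff exp_add field_simps)

context rect_lattice
begin

lemma cnj_wzeta_w: "cnj (\<zeta> w) = \<zeta> w"
proof -
  have "cnj w = w"
    using w_real by (simp add: complex_eq_iff)
  then show ?thesis
    using wzeta_cnj[of w] by simp
qed

lemma pfun_cnj: "pfun w w' (cnj z) = cnj (pfun w w' z)"
  using w_real cnj_wzeta_w by (simp add: pfun_def wzeta_cnj complex_eq_iff)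

lemma pfun_minus: "pfun w w' (- z) = - pfun w w' z"
  by (simp add: pfun_def wzeta_minus)

lemma pfun_w: "pfun w w' w = 0"
  by (simp add: pfun_def)

lemma pfun_add_2w: "z \<notin> \<Lambda> \<Longrightarrow> pfun w w' (z + 2 * w) = pfun w w' z"
  using wzeta_add_2w[of z] by (simp add: pfun_def algebra_simps)

lemma pfun_add_2w': "z \<notin> \<Lambda> \<Longrightarrow> pfun w w' (z + 2 * w') = pfun w w' z + pi * \<i>"
proof -
  assume "z \<notin> \<Lambda>"
  then have "pfun w w' (z + 2 * w') = pfun w w' z + 2 * (\<zeta> w * w' - \<zeta> w' * w)"
    using wzeta_add_2w'[of z] by (simp add: pfun_def algebra_simps)
  then show ?thesis
    by (simp add: legendre_relation)
qed

lemma Re_pfun_eq_0_if_Re_eq_0: "Re k = 0 \<Longrightarrow> Re (pfun w w' k) = 0"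
proof -
  assume "Re k = 0"
  then have "cnj k = - k"
    by (simp add: complex_eq_iff)
  then have "cnj (pfun w w' k) = - pfun w w' k"
    by (metis pfun_cnj pfun_minus)
  then show ?thesis
    by (simp add: complex_eq_iff)
qed

lemma Re_pfun_eq_0_if_Re_eq_Re_w: "Re k = Re w \<Longrightarrow> Re (pfun w w' k) = 0"
proof -
  assume k: "Re k = Re w"
  have "k - 2 * w \<notin> \<Lambda>"
    using k w_real w_pos by (intro not_in_lattice_if_abs_Re) simp
  then have "pfun w w' k = pfun w w' (k - 2 * w)"
    using pfun_add_2w[of "k - 2 * w"] by simp
  also have "k - 2 * w = - cnj k"
    using k w_real by (simp add: complex_eq_iff)
  finally have "pfun w w' k = - cnj (pfun w w' k)"
    by (simp add: pfun_minus pfun_cnj)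
  then show ?thesis
    by (simp add: complex_eq_iff)
qed

lemma Im_pfun_eq_if_Im_eq_Im_w': "Im k = Im w' \<Longrightarrow> Im (pfun w w' k) = pi / 2"
proof -
  assume k: "Im k = Im w'"
  have "k - 2 * w' \<notin> \<Lambda>"
    using k w'_imag w'_pos by (intro not_in_lattice_if_abs_Im) simp
  then have "pfun w w' k = pfun w w' (k - 2 * w') + pi * \<i>"
    using pfun_add_2w'[of "k - 2 * w'"] by simp
  also have "k - 2 * w' = cnj k"
    using k w'_imag by (simp add: complex_eq_iff)
  finally have "pfun w w' k = cnj (pfun w w' k) + pi * \<i>"
    by (simp add: pfun_cnj)
  from arg_cong[OF this, of Im] show ?thesis
    by simp
qed

lemma Im_pfun_eq_0_if_Im_eq_0: "Im k = 0 \<Longrightarrow> Im (pfun w w' k) = 0"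
proof -
  assume "Im k = 0"
  then have "cnj k = k"
    by (simp add: complex_eq_iff)
  then have "cnj (pfun w w' k) = pfun w w' k"
    using pfun_cnj[of k] by simp
  then show ?thesis
    by (simp add: complex_eq_iff)
qed

lemma PsiT_eq_vfun_exp: "PsiT w w' x k l = vfun w w' x k l * exp ((pfun w w' k + pfun w w' l) / w * x)"
proof -
  have "w \<noteq> 0"
    using w_pos by auto
  then have exponent: "- \<zeta> w' * (k + l) - (k + l) * \<zeta> w / w * x + (pfun w w' k + pfun w w' l) / w * x
      = - (\<zeta> k + \<zeta> l) * x - \<zeta> w' * (k + l)"
    by (simp add: pfun_def field_simps)
  have "x + w' + k + l = x + k + l + w'"
    by (simp add: algebra_simps)
  then have "vfun w w' x k l * exp ((pfun w w' k + pfun w w' l) / w * x)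
      = \<sigma> (x + k + l + w') / (\<sigma> (x + w') * \<sigma> (k + l)) *
        exp (- \<zeta> w' * (k + l) - (k + l) * \<zeta> w / w * x + (pfun w w' k + pfun w w' l) / w * x)"
    unfolding vfun_def by (simp only: exp_add mult.assoc)
  then show ?thesis
    unfolding exponent PsiT_def by simp
qed

lemma PsiT_add_2w:
  assumes "k \<notin> \<Lambda>"
  shows "PsiT w w' x (k + 2 * w) l = - PsiT w w' x k l"
proof -
  define E where "E = - (\<zeta> k + \<zeta> l) * x - \<zeta> w' * (k + l)"
  define \<eta> where "\<eta> = \<zeta> w"
  have 1: "\<sigma> (x + (k + 2 * w) + l + w') = - exp (2 * \<eta> * (x + k + l + w' + w)) * \<sigma> (x + k + l + w')"
    using wsigma_add_2w[of "x + k + l + w'"] by (simp add: \<eta>_def algebra_simps)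
  have 2: "\<sigma> (k + 2 * w + l) = - exp (2 * \<eta> * (k + l + w)) * \<sigma> (k + l)"
    using wsigma_add_2w[of "k + l"] by (simp add: \<eta>_def algebra_simps)
  have 3: "- (\<zeta> (k + 2 * w) + \<zeta> l) * x - \<zeta> w' * (k + 2 * w + l) = E - 2 * \<eta> * x - 2 * \<zeta> w' * w"
    using wzeta_add_2w[OF assms] by (simp add: E_def \<eta>_def algebra_simps)
  have "PsiT w w' x (k + 2 * w) l = \<sigma> (x + k + l + w') / (\<sigma> (x + w') * \<sigma> (k + l)) *
      exp (2 * \<eta> * (x + k + l + w' + w) - 2 * \<eta> * (k + l + w) + (E - 2 * \<eta> * x - 2 * \<zeta> w' * w))"
    unfolding PsiT_def 1 2 3 by (rule quasi_factor_ratio)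
  also have "2 * \<eta> * (x + k + l + w' + w) - 2 * \<eta> * (k + l + w) + (E - 2 * \<eta> * x - 2 * \<zeta> w' * w)
      = E + 2 * (\<zeta> w * w' - \<zeta> w' * w)"
    by (simp add: \<eta>_def algebra_simps)
  also have "\<dots> = E + pi * \<i>"
    by (simp add: legendre_relation)
  finally show ?thesis
    by (simp add: PsiT_def E_def exp_add)
qed

lemma PsiT_add_2w':
  assumes "k \<notin> \<Lambda>"
  shows "PsiT w w' x (k + 2 * w') l = PsiT w w' x k l"
proof -
  define E where "E = - (\<zeta> k + \<zeta> l) * x - \<zeta> w' * (k + l)"
  define \<eta>' where "\<eta>' = \<zeta> w'"
  have 1: "\<sigma> (x + (k + 2 * w') + l + w') = - exp (2 * \<eta>' * (x + k + l + w' + w')) * \<sigma> (x + k + l + w')"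
    using wsigma_add_2w'[of "x + k + l + w'"] by (simp add: \<eta>'_def algebra_simps)
  have 2: "\<sigma> (k + 2 * w' + l) = - exp (2 * \<eta>' * (k + l + w')) * \<sigma> (k + l)"
    using wsigma_add_2w'[of "k + l"] by (simp add: \<eta>'_def algebra_simps)
  have 3: "- (\<zeta> (k + 2 * w') + \<zeta> l) * x - \<zeta> w' * (k + 2 * w' + l) = E - 2 * \<eta>' * x - 2 * \<eta>' * w'"
    using wzeta_add_2w'[OF assms] by (simp add: E_def \<eta>'_def algebra_simps)
  have "PsiT w w' x (k + 2 * w') l = \<sigma> (x + k + l + w') / (\<sigma> (x + w') * \<sigma> (k + l)) *
      exp (2 * \<eta>' * (x + k + l + w' + w') - 2 * \<eta>' * (k + l + w') + (E - 2 * \<eta>' * x - 2 * \<eta>' * w'))"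
    unfolding PsiT_def 1 2 3 by (rule quasi_factor_ratio)
  also have "2 * \<eta>' * (x + k + l + w' + w') - 2 * \<eta>' * (k + l + w') + (E - 2 * \<eta>' * x - 2 * \<eta>' * w') = E"
    by (simp add: algebra_simps)
  finally show ?thesis
    by (simp add: PsiT_def E_def)
qed

lemma vfun_add_2w: "vfun w w' (x + 2 * w) a b = vfun w w' x a b"
proof -
  define E where "E = - \<zeta> w' * (a + b) - (a + b) * \<zeta> w / w * x"
  define \<eta> where "\<eta> = \<zeta> w"
  have 1: "\<sigma> (x + 2 * w + w' + a + b) = - exp (2 * \<eta> * (x + w' + a + b + w)) * \<sigma> (x + w' + a + b)"
    using wsigma_add_2w[of "x + w' + a + b"] by (simp add: \<eta>_def algebra_simps)
  have 2: "\<sigma> (x + 2 * w + w') = - exp (2 * \<eta> * (x + w' + w)) * \<sigma> (x + w')"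
    using wsigma_add_2w[of "x + w'"] by (simp add: \<eta>_def algebra_simps)
  have "w \<noteq> 0"
    using w_pos by auto
  then have 3: "- \<zeta> w' * (a + b) - (a + b) * \<eta> / w * (x + 2 * w) = E - 2 * \<eta> * (a + b)"
    by (simp add: E_def \<eta>_def field_simps)
  have "vfun w w' (x + 2 * w) a b = \<sigma> (x + w' + a + b) / (\<sigma> (a + b) * \<sigma> (x + w')) *
      exp (2 * \<eta> * (x + w' + a + b + w) - 2 * \<eta> * (x + w' + w) + (E - 2 * \<eta> * (a + b)))"
    unfolding vfun_def \<eta>_def[symmetric] 1 2 3 mult.commute[of "- exp _ * _" "\<sigma> (a + b)"]
    by (rule quasi_factor_ratio)
  also have "2 * \<eta> * (x + w' + a + b + w) - 2 * \<eta> * (x + w' + w) + (E - 2 * \<eta> * (a + b)) = E"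
    by (simp add: algebra_simps)
  finally show ?thesis
    by (simp add: vfun_def E_def \<eta>_def mult.commute)
qed

end

section \<open>Reality of wp on the period rectangle and monotonicity of p\<close>

lemma deriv_at_reflection_fixpoint:
  fixes f :: "complex \<Rightarrow> complex" and \<epsilon> :: real
  assumes S: "open S" "z0 \<in> S" and sym: "\<And>z. z \<in> S \<Longrightarrow> f (of_real \<epsilon> * cnj z + d) = cnj (f z)"
    and D: "(f has_field_derivative D) (at z0)" and fix0: "of_real \<epsilon> * cnj z0 + d = z0"
  shows "D = of_real \<epsilon> * cnj D"
proof -
  define u0 where "u0 = of_real \<epsilon> * z0 + cnj d"
  have "cnj u0 = z0"
    using fix0 by (simp add: u0_def)
  then have "((cnj \<circ> f \<circ> cnj) has_field_derivative cnj D) (at u0)"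
    using D by (intro has_field_derivative_cnj_cnj) simp
  moreover have "((\<lambda>z. of_real \<epsilon> * z + cnj d) has_field_derivative of_real \<epsilon>) (at z0)"
    by (auto intro!: derivative_eq_intros)
  ultimately have "((\<lambda>z. cnj (f (of_real \<epsilon> * cnj z + d))) has_field_derivative cnj D * of_real \<epsilon>) (at z0)"
    using DERIV_chain'[of "\<lambda>z. of_real \<epsilon> * z + cnj d" "of_real \<epsilon>" z0 UNIV "cnj \<circ> f \<circ> cnj" "cnj D"]
    by (simp add: u0_def o_def)
  then have "(f has_field_derivative cnj D * of_real \<epsilon>) (at z0)"
    by (rule has_field_derivative_transform_within_open[OF _ S]) (simp add: sym)
  then show ?thesis
    using D DERIV_unique by (auto simp: mult.commute)
qed

lemma tendsto_ray_at_right_0: "((\<lambda>t. u * complex_of_real t) \<longlongrightarrow> 0) (at_right 0)"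
  using tendsto_mult[OF tendsto_const[of u] tendsto_of_real[OF tendsto_ident_at[of "0::real" "{0<..}"]]]
  by simp

lemma stays_above_if_avoids:
  fixes \<phi> :: "real \<Rightarrow> real"
  assumes cont: "continuous_on {0<..b} \<phi>" and lim: "filterlim \<phi> at_top (at_right 0)"
    and avoid: "\<And>s. 0 < s \<Longrightarrow> s \<le> b \<Longrightarrow> \<phi> s \<noteq> c" and t: "0 < t" "t \<le> b"
  shows "c < \<phi> t"
proof (rule ccontr)
  assume "\<not> c < \<phi> t"
  then have le: "\<phi> t \<le> c"
    by simp
  have "eventually (\<lambda>s. c \<le> \<phi> s \<and> s \<in> {0<..<t}) (at_right 0)"
    using lim[unfolded filterlim_at_top] eventually_at_right_real[OF t(1)]
    by (auto elim: eventually_elim2)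
  then obtain s where s: "c \<le> \<phi> s" "0 < s" "s < t"
    using eventually_happens'[of "at_right (0::real)"] by auto
  have "continuous_on {s..t} \<phi>"
    using s t by (intro continuous_on_subset[OF cont]) auto
  then obtain r where "s \<le> r" "r \<le> t" "\<phi> r = c"
    using IVT2'[of \<phi> t c s] le s by auto
  with avoid[of r] s t show False
    by simp
qed

context rect_lattice
begin

lemma wp_cnj_add_2w': "z \<notin> \<Lambda> \<Longrightarrow> \<wp> (cnj z + 2 * w') = cnj (\<wp> z)"
  using wp_add_2w'[of "cnj z"] wp_cnj[of z] cnj_lattice_iff by simp

lemma wp_minus_cnj: "z \<notin> \<Lambda> \<Longrightarrow> \<wp> (- cnj z) = cnj (\<wp> z)"
  using wp_minus[of "cnj z"] wp_cnj[of z] cnj_lattice_iff by simp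

lemma continuous_on_Re_wp_path:
  assumes "continuous_on I \<gamma>" "\<And>t. t \<in> I \<Longrightarrow> \<gamma> t \<notin> \<Lambda>"
  shows "continuous_on I (\<lambda>t. Re (\<wp> (\<gamma> t)))"
proof -
  have "continuous_on I (\<lambda>t. \<wp> (\<gamma> t))"
    using assms
    by (intro continuous_on_compose2[OF holomorphic_on_imp_continuous_on[OF holomorphic_wp]]) auto
  then show ?thesis
    by (rule continuous_on_Re)
qed

lemma ball_gap_inter_lattice_subset: "ball 0 gap \<inter> \<Lambda> \<subseteq> {0}"
proof
  fix z assume z: "z \<in> ball 0 gap \<inter> \<Lambda>"
  then obtain p where p: "z = lpoint p"
    unfolding wlattice_eq_range by blast
  have "p = (0, 0)"
  proof (rule ccontr)
    assume "p \<noteq> (0, 0)"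
    then have "shell_index p \<noteq> 0"
      by (simp add: shell_index_eq_0_iff)
    then have "2 * gap * 1 \<le> 2 * gap * shell_index p"
      using gap_pos by (intro mult_left_mono) auto
    then have "2 * gap \<le> norm (lpoint p)"
      using norm_lpoint_ge[of p] by linarith
    with z p gap_pos show False
      by simp
  qed
  with p show "z \<in> {0}"
    by simp
qed

lemma wzeta_wp_principal_parts:
  obtains G where "G holomorphic_on ball 0 gap"
    "\<And>z. z \<in> ball 0 gap - {0} \<Longrightarrow> \<zeta> z = 1 / z + G z"
    "\<And>z. z \<in> ball 0 gap - {0} \<Longrightarrow> \<wp> z = 1 / z\<^sup>2 - deriv G z"
proof -
  obtain G where G: "G holomorphic_on ball 0 gap" "\<And>z. z \<in> ball 0 gap - {0} \<Longrightarrow> \<zeta> z = 1 / z + G z"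
    using wzeta_principal_part[OF open_ball subset_refl ball_gap_inter_lattice_subset gap_pos] by blast
  have "\<wp> z = 1 / z\<^sup>2 - deriv G z" if z: "z \<in> ball 0 gap - {0}" for z
  proof -
    have "z \<notin> \<Lambda>"
      using z ball_gap_inter_lattice_subset by auto
    have "(G has_field_derivative deriv G z) (at z)"
      using holomorphic_derivI[OF G(1) open_ball, of z] z by simp
    then have "((\<lambda>z. 1 / z + G z) has_field_derivative - 1 / z\<^sup>2 + deriv G z) (at z)"
      using z by (auto intro!: derivative_eq_intros simp: power2_eq_square field_simps)
    then have "(\<zeta> has_field_derivative - 1 / z\<^sup>2 + deriv G z) (at z)"
      by (rule has_field_derivative_transform_within_open[of _ _ _ "ball 0 gap - {0}"])
         (use z G(2) in \<open>auto simp: open_Diff\<close>)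
    then have "- \<wp> z = - 1 / z\<^sup>2 + deriv G z"
      by (rule DERIV_unique[OF wzeta_has_field_derivative[OF \<open>z \<notin> \<Lambda>\<close>]])
    then show ?thesis
      by (simp add: field_simps)
  qed
  with G that show ?thesis
    by blast
qed

lemma Re_wp_real_axis_tendsto: "filterlim (\<lambda>t. Re (\<wp> (of_real t))) at_top (at_right 0)"
proof -
  obtain G where G: "G holomorphic_on ball 0 gap"
    "\<And>z. z \<in> ball 0 gap - {0} \<Longrightarrow> \<wp> z = 1 / z\<^sup>2 - deriv G z"
    using wzeta_wp_principal_parts by metis
  have "isCont (deriv G) 0"
    using holomorphic_on_imp_continuous_on[OF holomorphic_deriv[OF G(1) open_ball]] gap_pos
    by (simp add: continuous_on_eq_continuous_at)
  then have "((\<lambda>t. - Re (deriv G (1 * of_real t))) \<longlongrightarrow> - Re (deriv G 0)) (at_right 0)"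
    by (intro tendsto_minus tendsto_Re isCont_tendsto_compose[OF _ tendsto_ray_at_right_0])
  moreover have "filterlim (\<lambda>t. inverse t ^ 2) at_top (at_right (0::real))"
    by (rule filterlim_pow_at_top[OF _ filterlim_inverse_at_top_right]) simp
  ultimately have "filterlim (\<lambda>t. - Re (deriv G (of_real t)) + inverse t ^ 2) at_top (at_right 0)"
    using filterlim_tendsto_add_at_top by fastforce
  moreover have "eventually (\<lambda>t. - Re (deriv G (of_real t)) + inverse t ^ 2 = Re (\<wp> (of_real t)))
      (at_right 0)"
    using eventually_at_right_real[OF gap_pos]
  proof eventually_elim
    case (elim t)
    then have "complex_of_real t \<in> ball 0 gap - {0}"
      by auto
    then show ?case
      using G(2) by (simp add: power_inverse inverse_eq_divide power_one_over)
  qed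
  ultimately show ?thesis
    by (rule filterlim_cong[THEN iffD1, OF refl refl, rotated])
qed

lemma Re_wp_imag_axis_tendsto: "filterlim (\<lambda>y. - Re (\<wp> (\<i> * of_real y))) at_top (at_right 0)"
proof -
  obtain G where G: "G holomorphic_on ball 0 gap"
    "\<And>z. z \<in> ball 0 gap - {0} \<Longrightarrow> \<wp> z = 1 / z\<^sup>2 - deriv G z"
    using wzeta_wp_principal_parts by metis
  have "isCont (deriv G) 0"
    using holomorphic_on_imp_continuous_on[OF holomorphic_deriv[OF G(1) open_ball]] gap_pos
    by (simp add: continuous_on_eq_continuous_at)
  then have "((\<lambda>t. Re (deriv G (\<i> * of_real t))) \<longlongrightarrow> Re (deriv G 0)) (at_right 0)"
    by (intro tendsto_Re isCont_tendsto_compose[OF _ tendsto_ray_at_right_0])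
  moreover have "filterlim (\<lambda>t. inverse t ^ 2) at_top (at_right (0::real))"
    by (rule filterlim_pow_at_top[OF _ filterlim_inverse_at_top_right]) simp
  ultimately have "filterlim (\<lambda>t. Re (deriv G (\<i> * of_real t)) + inverse t ^ 2) at_top (at_right 0)"
    using filterlim_tendsto_add_at_top by fastforce
  moreover have "eventually (\<lambda>t. Re (deriv G (\<i> * of_real t)) + inverse t ^ 2 = - Re (\<wp> (\<i> * of_real t)))
      (at_right 0)"
    using eventually_at_right_real[OF gap_pos]
  proof eventually_elim
    case (elim t)
    then have "\<i> * complex_of_real t \<in> ball 0 gap - {0}"
      by (auto simp: norm_mult)
    moreover have "1 / (\<i> * complex_of_real t)\<^sup>2 = - complex_of_real (1 / t\<^sup>2)"
      by (simp add: power_mult_distrib)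
    ultimately have "\<wp> (\<i> * of_real t) = - complex_of_real (1 / t\<^sup>2) - deriv G (\<i> * of_real t)"
      using G(2) by simp
    then show ?case
      by (simp add: power_one_over inverse_eq_divide)
  qed
  ultimately show ?thesis
    by (rule filterlim_cong[THEN iffD1, OF refl refl, rotated])
qed

end

locale real_weierstrass = rect_lattice +
  fixes g2 g3 :: real
  assumes discriminant_pos: "g2 ^ 3 - 27 * g3\<^sup>2 > 0"
    and wp_ode: "\<forall>z. z \<notin> wlattice w w' \<longrightarrow>
        (deriv (wp w w') z)\<^sup>2 = 4 * (wp w w' z) ^ 3 - of_real g2 * wp w w' z - of_real g3"
begin

definition cubic :: "real \<Rightarrow> real" where
  "cubic x = 4 * x ^ 3 - g2 * x - g3"

definition crit :: real where
  "crit = sqrt (g2 / 12)"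

lemma g2_pos: "g2 > 0"
proof (rule ccontr)
  assume "\<not> g2 > 0"
  then have "g2 * g2\<^sup>2 \<le> 0"
    by (intro mult_nonpos_nonneg) auto
  then have "g2 ^ 3 \<le> 0"
    by (simp add: power3_eq_cube power2_eq_square)
  with discriminant_pos show False
    by (smt (verit) zero_le_power2)
qed

lemma crit_nonneg: "0 \<le> crit"
  using g2_pos by (simp add: crit_def)

lemma cubic_crit: "cubic crit < 0" "0 < cubic (- crit)"
proof -
  define q where "q = 8 * crit ^ 3"
  have crit2: "crit\<^sup>2 = g2 / 12"
    using g2_pos by (simp add: crit_def)
  have "0 \<le> q"
    using crit_nonneg by (simp add: q_def)
  have "q\<^sup>2 = 64 * (crit\<^sup>2) ^ 3"
    by (simp add: q_def power_mult_distrib power_mult[symmetric])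
  also have "\<dots> = g2 ^ 3 / 27"
    by (simp add: crit2 power_divide)
  finally have "\<bar>g3\<bar>\<^sup>2 < q\<^sup>2"
    using discriminant_pos by simp
  then have "\<bar>g3\<bar> < q"
    using \<open>0 \<le> q\<close> by (rule power2_less_imp_less)
  moreover have "cubic crit = - q - g3" "cubic (- crit) = q - g3"
    using crit2 by (simp_all add: cubic_def q_def power3_eq_cube power2_eq_square algebra_simps)
  ultimately show "cubic crit < 0" "0 < cubic (- crit)"
    by linarith+
qed

lemma wp_on_reflection_line:
  assumes z0: "z0 \<notin> \<Lambda>" and \<epsilon>: "\<epsilon> = 1 \<or> \<epsilon> = - 1"
    and sym: "\<And>z. z \<notin> \<Lambda> \<Longrightarrow> \<wp> (of_real \<epsilon> * cnj z + d) = cnj (\<wp> z)"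
    and fix0: "of_real \<epsilon> * cnj z0 + d = z0"
  shows "Im (\<wp> z0) = 0" and "0 \<le> \<epsilon> * cubic (Re (\<wp> z0))"
proof -
  have "\<wp> z0 = cnj (\<wp> z0)"
    using sym[OF z0] fix0 by simp
  from arg_cong[OF this, of Im] show im: "Im (\<wp> z0) = 0"
    by simp
  define D where "D = deriv \<wp> z0"
  have D: "D = of_real \<epsilon> * cnj D"
    unfolding D_def using z0 sym fix0
    by (intro deriv_at_reflection_fixpoint[OF open_lattice_complement _ _ wp_has_field_derivative]) auto
  have "complex_of_real (cubic (Re (\<wp> z0))) = D\<^sup>2"
    using wp_ode z0 im by (simp add: D_def cubic_def complex_eq_iff)
  also have "\<dots> = D * (of_real \<epsilon> * cnj D)"
    using D by (simp add: power2_eq_square)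
  also have "\<dots> = of_real \<epsilon> * (D * cnj D)"
    by (simp add: mult_ac)
  also have "\<dots> = of_real (\<epsilon> * (cmod D)\<^sup>2)"
    by (simp only: complex_norm_square of_real_mult)
  finally have "cubic (Re (\<wp> z0)) = \<epsilon> * (cmod D)\<^sup>2"
    using of_real_eq_iff by blast
  then show "0 \<le> \<epsilon> * cubic (Re (\<wp> z0))"
    using \<epsilon> by auto
qed

lemma wp_real_axis:
  assumes "0 < t" "t < 2 * Re w"
  shows "Im (\<wp> (of_real t)) = 0" "0 \<le> cubic (Re (\<wp> (of_real t)))"
proof -
  have "complex_of_real t \<notin> \<Lambda>"
    using assms not_in_lattice_ReI[of 0] by simp
  then show "Im (\<wp> (of_real t)) = 0" "0 \<le> cubic (Re (\<wp> (of_real t)))"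
    using wp_on_reflection_line[of _ 1 0] wp_cnj by simp_all
qed

lemma wp_top_edge: "Im (\<wp> (of_real x + w')) = 0" "0 \<le> cubic (Re (\<wp> (of_real x + w')))"
proof -
  have "complex_of_real x + w' \<notin> \<Lambda>"
    using w'_pos by (intro not_in_lattice_if_abs_Im) simp
  moreover have "cnj (complex_of_real x + w') + 2 * w' = complex_of_real x + w'"
    using w'_imag by (simp add: complex_eq_iff)
  ultimately show "Im (\<wp> (of_real x + w')) = 0" "0 \<le> cubic (Re (\<wp> (of_real x + w')))"
    using wp_on_reflection_line[of _ 1 "2 * w'"] wp_cnj_add_2w' by simp_all
qed

lemma wp_imag_axis:
  assumes "0 < y" "y < 2 * Im w'"
  shows "Im (\<wp> (\<i> * of_real y)) = 0" "cubic (Re (\<wp> (\<i> * of_real y))) \<le> 0"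
proof -
  have "\<i> * complex_of_real y \<notin> \<Lambda>"
    using assms not_in_lattice_ImI[of 0] by simp
  then show "Im (\<wp> (\<i> * of_real y)) = 0" "cubic (Re (\<wp> (\<i> * of_real y))) \<le> 0"
    using wp_on_reflection_line[of _ "- 1" 0] wp_minus_cnj by simp_all
qed

lemma Re_wp_real_axis_gt_crit:
  assumes "0 < t" "t \<le> Re w"
  shows "crit < Re (\<wp> (of_real t))"
proof (rule stays_above_if_avoids[OF _ Re_wp_real_axis_tendsto _ assms])
  show "continuous_on {0<..Re w} (\<lambda>t. Re (\<wp> (of_real t)))"
    using w_pos not_in_lattice_ReI[of 0]
    by (intro continuous_on_Re_wp_path continuous_intros) auto
  show "Re (\<wp> (of_real s)) \<noteq> crit" if "0 < s" "s \<le> Re w" for s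
    using wp_real_axis[of s] that w_pos cubic_crit by auto
qed

lemma Re_wp_w'_lt: "Re (\<wp> w') < - crit"
proof -
  have "crit < - Re (\<wp> (\<i> * of_real (Im w')))"
  proof (rule stays_above_if_avoids[OF _ Re_wp_imag_axis_tendsto])
    show "continuous_on {0<..Im w'} (\<lambda>y. - Re (\<wp> (\<i> * of_real y)))"
      using w'_pos not_in_lattice_ImI[of 0]
      by (intro continuous_on_minus continuous_on_Re_wp_path continuous_intros) auto
    show "- Re (\<wp> (\<i> * of_real s)) \<noteq> crit" if "0 < s" "s \<le> Im w'" for s
    proof
      assume "- Re (\<wp> (\<i> * of_real s)) = crit"
      then have "Re (\<wp> (\<i> * of_real s)) = - crit"
        by simp
      with wp_imag_axis(2)[of s] that w'_pos cubic_crit show False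
        by simp
    qed
  qed (use w'_pos in auto)
  moreover have "\<i> * of_real (Im w') = w'"
    using w'_imag by (simp add: complex_eq_iff)
  ultimately show ?thesis
    by simp
qed

lemma Re_wp_top_edge_lt_crit:
  assumes "0 \<le> x"
  shows "Re (\<wp> (of_real x + w')) < crit"
proof (rule ccontr)
  assume "\<not> ?thesis"
  then have "crit \<le> Re (\<wp> (of_real x + w'))"
    by simp
  moreover have "Re (\<wp> (of_real 0 + w')) \<le> crit"
    using Re_wp_w'_lt crit_nonneg by simp
  moreover have "continuous_on {0..x} (\<lambda>t. Re (\<wp> (of_real t + w')))"
    using w'_pos not_in_lattice_if_abs_Im
    by (intro continuous_on_Re_wp_path continuous_intros) auto
  ultimately obtain y where "Re (\<wp> (of_real y + w')) = crit"
    using IVT'[of "\<lambda>t. Re (\<wp> (of_real t + w'))" 0 crit x] assms by auto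
  with wp_top_edge(2)[of y] cubic_crit show False
    by simp
qed

lemma Re_wzeta_w_gt: "- Re w * crit < Re (\<zeta> w)"
proof -
  define \<phi> where "\<phi> x = Re (\<zeta> (of_real x + w'))" for x
  have deriv: "(\<phi> has_real_derivative Re (- \<wp> (of_real x + w'))) (at x)" for x
  proof -
    have "of_real x + w' \<notin> \<Lambda>"
      using w'_pos by (intro not_in_lattice_if_abs_Im) simp
    then have "((\<lambda>z. \<zeta> (z + w')) has_field_derivative - \<wp> (of_real x + w') * 1) (at (of_real x))"
      by (intro DERIV_chain'[of "\<lambda>z. z + w'" 1 "of_real x" UNIV \<zeta>])
         (auto intro!: derivative_eq_intros wzeta_has_field_derivative)
    then have "((\<lambda>t. \<zeta> (of_real t + w')) has_vector_derivative - \<wp> (of_real x + w')) (at x)"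
      using has_vector_derivative_real_field by fastforce
    then show ?thesis
      unfolding \<phi>_def by (rule has_field_derivative_Re)
  qed
  then obtain \<xi> where \<xi>: "0 < \<xi>" "\<xi> < 2 * Re w"
    "\<phi> (2 * Re w) - \<phi> 0 = (2 * Re w - 0) * Re (- \<wp> (of_real \<xi> + w'))"
    using MVT2[of 0 "2 * Re w" \<phi> "\<lambda>x. Re (- \<wp> (of_real x + w'))"] deriv w_pos by auto
  have "of_real (2 * Re w) = 2 * w"
    using w_real by (simp add: complex_eq_iff)
  then have "\<phi> (2 * Re w) - \<phi> 0 = 2 * Re (\<zeta> w)"
    using wzeta_add_2w[OF w'_notin_lattice] by (simp add: \<phi>_def add.commute)
  with \<xi> have "Re (\<zeta> w) = Re w * - Re (\<wp> (of_real \<xi> + w'))"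
    by simp
  moreover have "Re (\<wp> (of_real \<xi> + w')) < crit"
    using Re_wp_top_edge_lt_crit \<xi> by simp
  ultimately show ?thesis
    using w_pos by (simp add: mult_strict_left_mono)
qed

lemma pfun_real_has_derivative:
  assumes "0 < t" "t < 2 * Re w"
  shows "((\<lambda>t. Re (pfun w w' (of_real t))) has_real_derivative
    Re (\<zeta> w) + Re w * Re (\<wp> (of_real t))) (at t)"
proof -
  have "of_real t \<notin> \<Lambda>"
    using assms not_in_lattice_ReI[of 0] by simp
  then have "(pfun w w' has_field_derivative \<zeta> w - w * - \<wp> (of_real t)) (at (of_real t))"
    unfolding pfun_def[abs_def] by (auto intro!: derivative_eq_intros wzeta_has_field_derivative)
  then have "((\<lambda>t. pfun w w' (of_real t)) has_vector_derivative \<zeta> w - w * - \<wp> (of_real t)) (at t)"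
    using has_vector_derivative_real_field by fastforce
  from has_field_derivative_Re[OF this] show ?thesis
    using w_real by simp
qed

lemma mono_on_pfun_real: "mono_on {0<..Re w} (\<lambda>t. Re (pfun w w' (of_real t)))"
proof (rule mono_onI)
  fix r s assume rs: "r \<in> {0<..Re w}" "s \<in> {0<..Re w}" "r \<le> s"
  show "Re (pfun w w' (of_real r)) \<le> Re (pfun w w' (of_real s))"
  proof (rule DERIV_nonneg_imp_nondecreasing[OF rs(3)])
    fix x assume x: "r \<le> x" "x \<le> s"
    then have "0 < x" "x \<le> Re w"
      using rs by auto
    then have "Re w * crit < Re w * Re (\<wp> (of_real x))"
      using Re_wp_real_axis_gt_crit[of x] w_pos by (intro mult_strict_left_mono)
    then have "0 \<le> Re (\<zeta> w) + Re w * Re (\<wp> (of_real x))"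
      using Re_wzeta_w_gt by linarith
    with pfun_real_has_derivative[of x] \<open>0 < x\<close> \<open>x \<le> Re w\<close> w_pos
    show "\<exists>y. ((\<lambda>t. Re (pfun w w' (of_real t))) has_real_derivative y) (at x) \<and> 0 \<le> y"
      by auto
  qed
qed

lemma Re_pfun_real_tendsto: "filterlim (\<lambda>t. Re (pfun w w' (of_real t))) at_bot (at_right 0)"
proof -
  obtain G where G: "G holomorphic_on ball 0 gap"
    "\<And>z. z \<in> ball 0 gap - {0} \<Longrightarrow> \<zeta> z = 1 / z + G z"
    using wzeta_wp_principal_parts by metis
  have "isCont G 0"
    using holomorphic_on_imp_continuous_on[OF G(1)] gap_pos by (simp add: continuous_on_eq_continuous_at)
  then have "((\<lambda>t. t * Re (\<zeta> w) - Re w * Re (G (1 * of_real t))) \<longlongrightarrow> 0 * Re (\<zeta> w) - Re w * Re (G 0))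
      (at_right 0)"
    by (intro tendsto_intros isCont_tendsto_compose[OF _ tendsto_ray_at_right_0])
  moreover have "filterlim (\<lambda>t. - (Re w * inverse t)) at_bot (at_right (0::real))"
    using filterlim_tendsto_pos_mult_at_top[OF tendsto_const w_pos filterlim_inverse_at_top_right]
    by (simp add: filterlim_uminus_at_top)
  ultimately have "filterlim (\<lambda>t. (t * Re (\<zeta> w) - Re w * Re (G (of_real t))) + - (Re w * inverse t))
      at_bot (at_right 0)"
    using filterlim_tendsto_add_at_bot_iff by fastforce
  moreover have "eventually (\<lambda>t. (t * Re (\<zeta> w) - Re w * Re (G (of_real t))) + - (Re w * inverse t)
      = Re (pfun w w' (of_real t))) (at_right 0)"
    using eventually_at_right_real[OF gap_pos]
  proof eventually_elim
    case (elim t)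
    then have "complex_of_real t \<in> ball 0 gap - {0}"
      by auto
    then show ?case
      using G(2) w_real by (simp add: pfun_def inverse_eq_divide algebra_simps)
  qed
  ultimately show ?thesis
    by (rule filterlim_cong[THEN iffD1, OF refl refl, rotated])
qed

end

theorem proposition2p2:
  fixes g2 g3 :: real and w w' :: complex
  assumes disc: "g2 ^ 3 - 27 * g3\<^sup>2 > 0"
    and w_real: "Im w = 0" and w_pos: "Re w > 0"
    and w'_imag: "Re w' = 0" and w'_pos: "Im w' > 0"
    and invariants: "\<forall>z. z \<notin> wlattice w w' \<longrightarrow>
        (deriv (wp w w') z)\<^sup>2 = 4 * (wp w w' z) ^ 3 - of_real g2 * wp w w' z - of_real g3"
  shows
    "(\<forall>x k l. PsiT w w' x k l = vfun w w' x k l * exp ((pfun w w' k + pfun w w' l) / w * x))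
   \<and> (\<forall>x k l. k \<notin> wlattice w w' \<and> l \<notin> wlattice w w' \<longrightarrow>
        PsiT w w' x (k + 2 * w) l = - PsiT w w' x k l \<and>
        PsiT w w' x (k + 2 * w') l = PsiT w w' x k l)
   \<and> (\<forall>x k l. vfun w w' (x + 2 * w) k l = vfun w w' x k l)
   \<and> (\<forall>k. k \<notin> wlattice w w' \<longrightarrow>
        pfun w w' (k + 2 * w) = pfun w w' k \<and>
        pfun w w' (k + 2 * w') = pfun w w' k + pi * \<i> \<and>
        pfun w w' (- k) = - pfun w w' k)
   \<and> (\<forall>k \<in> (closed_segment 0 w' - {0}) \<union> (closed_segment w (w + w') - {w}).
        Re (pfun w w' k) = 0)
   \<and> (\<forall>k \<in> open_segment w' (w + w'). Im (pfun w w' k) = pi / 2)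
   \<and> (\<forall>k \<in> closed_segment 0 w - {0}. Im (pfun w w' k) = 0)
   \<and> mono_on {0<..Re w} (\<lambda>t. Re (pfun w w' (of_real t)))
   \<and> filterlim (\<lambda>t. Re (pfun w w' (of_real t))) at_bot (at_right 0)
   \<and> pfun w w' w = 0"
proof -
  interpret real_weierstrass w w' g2 g3
    using w_real w_pos w'_imag w'_pos disc invariants by unfold_locales
  have "\<forall>k \<in> (closed_segment 0 w' - {0}) \<union> (closed_segment w (w + w') - {w}). Re (pfun w w' k) = 0"
    using w'_imag Re_pfun_eq_0_if_Re_eq_0 Re_pfun_eq_0_if_Re_eq_Re_w by (auto simp: closed_segment_same_Re)
  moreover have "\<forall>k \<in> open_segment w' (w + w'). Im (pfun w w' k) = pi / 2"
    using w_real Im_pfun_eq_if_Im_eq_Im_w' open_closed_segment by (fastforce simp: closed_segment_same_Im)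
  moreover have "\<forall>k \<in> closed_segment 0 w - {0}. Im (pfun w w' k) = 0"
    using w_real Im_pfun_eq_0_if_Im_eq_0 by (auto simp: closed_segment_same_Im)
  ultimately show ?thesis
    using PsiT_eq_vfun_exp PsiT_add_2w PsiT_add_2w' vfun_add_2w pfun_add_2w pfun_add_2w' pfun_minus
      mono_on_pfun_real Re_pfun_real_tendsto pfun_w
    by blast
qed

end
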